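(* Let $T$ be a line trigraph in $\mathcal F$ that contains no odd prism. Then: (1) $T$ is either complete or has an even pair; (2) if $T$ is favorable, then $T$ has an even pair disjoint from its switchable component.
   Context: A trigraph $T$ consists of a finite set $V(T)$ and a map $\theta:\binom{V(T)}{2}\to\{-1,0,1\}$. Two distinct vertices $u,v$ are strongly adjacent if $\theta(uv)=1$, strongly antiadjacent if $\theta(uv)=-1$, and semiadjacent (a switchable pair) if $\theta(uv)=0$; they are adjacent if $\theta(uv)\in\{0,1\}$ and antiadjacent if $\theta(uv)\in\{0,-1\}$. $N(v)$ is the set of vertices adjacent to $v$. For $X\subseteq V(T)$, $T|X$ is the trigraph on $X$ with $\theta$ restricted, and $T\setminus X=T|(V(T)\setminus X)$; $T$ contains $H$ if $H$ is isomorphic to some $T|X$. A clique (strong clique) is a set of pairwise adjacent (strongly adjacent) vertices; $T$ is complete if $V(T)$ is a clique. The full realization of $T$ is the graph on $V(T)$ whose edges are the adjacent pairs. A path is a sequence of distinct vertices $p_1,\dots,p_k$ such that $p_i,p_j$ are adjacent when $|i-j|=1$ and antiadjacent when $|i-j|>1$; its length is $k-1$, even or odd accordingly. A hole of length $k\ge5$ consists of vertices $h_1,\dots,h_k$ with $h_i,h_j$ adjacent if $|i-j|\in\{1,k-1\}$ and antiadjacent otherwise; an antihole is an induced subtrigraph whose complement (adjacency function $-\theta$) is a hole. $T$ is Berge if it contains no hole of odd length and no antihole of odd length. A prism is an induced subtrigraph whose full realization consists of two vertex-disjoint triangles $\{a_1,a_2,a_3\}$, $\{b_1,b_2,b_3\}$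 and three vertex-disjoint paths $P_i$ from $a_i$ to $b_i$ with no other edges; it is odd if all three $P_i$ have odd length. An even pair of $T$ is a strongly antiadjacent pair $\{u,v\}$ such that every path from $u$ to $v$ in $T$ has even length. $\Sigma(T)$ is the graph on $V(T)$ whose edges are the switchable pairs of $T$; a switchable component is a connected component of $\Sigma(T)$ with at least two vertices. $\mathcal F$ is the class of Berge trigraphs $T$ such that: (1) $T$ has at most one switchable component, and it has at most two edges; (2) if the switchable component has exactly one edge $xy$, then $N(x)\cap N(y)=\emptyset$ (it is called small); (3) if it has two edges, with $v$ the vertex of degree two in $\Sigma(T)$ and $x,y$ its neighbours, then $v$ is strongly anticomplete to $V(T)\setminus\{v,x,y\}$, $x$ is strongly antiadjacent to $y$, and $N(x)\cap N(y)=\{v\}$ (it is called light). For $T\in\mathcal F$, $D$ denotes the vertex set of its switchable component ($D=\emptyset$ if $T$ has no switchable pair). A pair $\{u,v\}$ is disjoint from the switchable component if $\{u,v\}\cap D=\emptyset$. A trigraph $T\in\mathcal F$ is favorable if (1) $|V(T)|\ge5$; (2) $T$ has a strongly antiadjacent pair $\{u,v\}$ disjoint from $D$; and (3) if $D=\{x,y\}$ is small, then at least one of $V(T)\setminus(D\cup N(x))$, $V(T)\setminus(D\cup N(y))$ is not a clique. $T$ is a line trigraph if its full realization is the line graph of a bipartite graph and every clique of size at least $3$ in $T$ is a strong clique. *)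

theory Defs
  imports Main
begin

text \<open>A trigraph: a finite vertex set and a symmetric map theta on pairs of distinct
vertices with values in {-1,0,1}. Values of theta on equal vertices or outside the
vertex set are irrelevant.\<close>

record 'a trigraph =
  verts :: "'a set"
  theta :: "'a \<Rightarrow> 'a \<Rightarrow> int"

definition is_trigraph :: "'a trigraph \<Rightarrow> bool" where
  "is_trigraph T \<longleftrightarrow> finite (verts T) \<and>
     (\<forall>u\<in>verts T. \<forall>v\<in>verts T. u \<noteq> v \<longrightarrow>
        theta T u v = theta T v u \<and> theta T u v \<in> {-1, 0, 1})"

definition strongly_adj :: "'a trigraph \<Rightarrow> 'a \<Rightarrow> 'a \<Rightarrow> bool" where
  "strongly_adj T u v \<longleftrightarrow> u \<in> verts T \<and> v \<in> verts T \<and> u \<noteq> v \<and> theta T u v = 1"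

definition strongly_antiadj :: "'a trigraph \<Rightarrow> 'a \<Rightarrow> 'a \<Rightarrow> bool" where
  "strongly_antiadj T u v \<longleftrightarrow> u \<in> verts T \<and> v \<in> verts T \<and> u \<noteq> v \<and> theta T u v = -1"

definition semiadj :: "'a trigraph \<Rightarrow> 'a \<Rightarrow> 'a \<Rightarrow> bool" where
  "semiadj T u v \<longleftrightarrow> u \<in> verts T \<and> v \<in> verts T \<and> u \<noteq> v \<and> theta T u v = 0"

definition adj :: "'a trigraph \<Rightarrow> 'a \<Rightarrow> 'a \<Rightarrow> bool" where
  "adj T u v \<longleftrightarrow> u \<in> verts T \<and> v \<in> verts T \<and> u \<noteq> v \<and> theta T u v \<in> {0, 1}"

definition antiadj :: "'a trigraph \<Rightarrow> 'a \<Rightarrow> 'a \<Rightarrow> bool" where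
  "antiadj T u v \<longleftrightarrow> u \<in> verts T \<and> v \<in> verts T \<and> u \<noteq> v \<and> theta T u v \<in> {0, -1}"

definition nbhd :: "'a trigraph \<Rightarrow> 'a \<Rightarrow> 'a set" where
  "nbhd T v = {u \<in> verts T. adj T v u}"

definition is_clique :: "'a trigraph \<Rightarrow> 'a set \<Rightarrow> bool" where
  "is_clique T K \<longleftrightarrow> K \<subseteq> verts T \<and> (\<forall>u\<in>K. \<forall>v\<in>K. u \<noteq> v \<longrightarrow> adj T u v)"

definition is_strong_clique :: "'a trigraph \<Rightarrow> 'a set \<Rightarrow> bool" where
  "is_strong_clique T K \<longleftrightarrow> K \<subseteq> verts T \<and> (\<forall>u\<in>K. \<forall>v\<in>K. u \<noteq> v \<longrightarrow> strongly_adj T u v)"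

definition complete :: "'a trigraph \<Rightarrow> bool" where
  "complete T \<longleftrightarrow> is_clique T (verts T)"

definition is_path :: "'a trigraph \<Rightarrow> 'a list \<Rightarrow> bool" where
  "is_path T p \<longleftrightarrow> p \<noteq> [] \<and> distinct p \<and> set p \<subseteq> verts T \<and>
     (\<forall>i<length p. \<forall>j<length p.
        (i + 1 = j \<or> j + 1 = i \<longrightarrow> adj T (p ! i) (p ! j)) \<and>
        (i + 1 < j \<or> j + 1 < i \<longrightarrow> antiadj T (p ! i) (p ! j)))"

definition path_len :: "'a list \<Rightarrow> nat" where
  "path_len p = length p - 1"

definition cyc_consec :: "nat \<Rightarrow> nat \<Rightarrow> nat \<Rightarrow> bool" where
  "cyc_consec k i j \<longleftrightarrow> j = Suc i mod k \<or> i = Suc j mod k"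

definition is_hole :: "'a trigraph \<Rightarrow> 'a list \<Rightarrow> bool" where
  "is_hole T h \<longleftrightarrow> length h \<ge> 5 \<and> distinct h \<and> set h \<subseteq> verts T \<and>
     (\<forall>i<length h. \<forall>j<length h. i \<noteq> j \<longrightarrow>
        (cyc_consec (length h) i j \<longrightarrow> adj T (h ! i) (h ! j)) \<and>
        (\<not> cyc_consec (length h) i j \<longrightarrow> antiadj T (h ! i) (h ! j)))"

text \<open>An antihole: its complement (theta replaced by -theta) is a hole; adjacency in the
complement is antiadjacency in T and vice versa.\<close>

definition is_antihole :: "'a trigraph \<Rightarrow> 'a list \<Rightarrow> bool" where
  "is_antihole T h \<longleftrightarrow> is_hole (T\<lparr>theta := (\<lambda>u v. - theta T u v)\<rparr>) h"

definition berge :: "'a trigraph \<Rightarrow> bool" where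
  "berge T \<longleftrightarrow> \<not> (\<exists>h. is_hole T h \<and> odd (length h)) \<and>
                \<not> (\<exists>h. is_antihole T h \<and> odd (length h))"

definition consec_in :: "'a list \<Rightarrow> 'a \<Rightarrow> 'a \<Rightarrow> bool" where
  "consec_in p u w \<longleftrightarrow> (\<exists>j. Suc j < length p \<and>
     ((p ! j = u \<and> p ! Suc j = w) \<or> (p ! j = w \<and> p ! Suc j = u)))"

text \<open>The lists P1, P2, P3 are the paths from a_i = hd Pi to b_i = last Pi; the induced
subtrigraph on their union has full realization exactly the prism graph.\<close>

definition is_prism :: "'a trigraph \<Rightarrow> 'a list \<Rightarrow> 'a list \<Rightarrow> 'a list \<Rightarrow> bool" where
  "is_prism T P1 P2 P3 \<longleftrightarrow>
     length P1 \<ge> 2 \<and> length P2 \<ge> 2 \<and> length P3 \<ge> 2 \<and>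
     distinct P1 \<and> distinct P2 \<and> distinct P3 \<and>
     set P1 \<inter> set P2 = {} \<and> set P1 \<inter> set P3 = {} \<and> set P2 \<inter> set P3 = {} \<and>
     set P1 \<union> set P2 \<union> set P3 \<subseteq> verts T \<and>
     (\<forall>u\<in>set P1 \<union> set P2 \<union> set P3. \<forall>w\<in>set P1 \<union> set P2 \<union> set P3. u \<noteq> w \<longrightarrow>
        (adj T u w \<longleftrightarrow>
           ({u, w} \<subseteq> {hd P1, hd P2, hd P3}) \<or>
           ({u, w} \<subseteq> {last P1, last P2, last P3}) \<or>
           consec_in P1 u w \<or> consec_in P2 u w \<or> consec_in P3 u w))"

definition contains_odd_prism :: "'a trigraph \<Rightarrow> bool" where
  "contains_odd_prism T \<longleftrightarrow> (\<exists>P1 P2 P3. is_prism T P1 P2 P3 \<and>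
     odd (path_len P1) \<and> odd (path_len P2) \<and> odd (path_len P3))"

definition even_pair :: "'a trigraph \<Rightarrow> 'a \<Rightarrow> 'a \<Rightarrow> bool" where
  "even_pair T u v \<longleftrightarrow> strongly_antiadj T u v \<and>
     (\<forall>p. is_path T p \<and> hd p = u \<and> last p = v \<longrightarrow> even (path_len p))"

definition sw_components :: "'a trigraph \<Rightarrow> 'a set set" where
  "sw_components T = {C. \<exists>v\<in>verts T. C = {u. (semiadj T)\<^sup>*\<^sup>* v u} \<and> card C \<ge> 2}"

definition sw_edges_in :: "'a trigraph \<Rightarrow> 'a set \<Rightarrow> 'a set set" where
  "sw_edges_in T C = {{u, v} | u v. u \<in> C \<and> v \<in> C \<and> semiadj T u v}"

definition swD :: "'a trigraph \<Rightarrow> 'a set" where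
  "swD T = \<Union> (sw_components T)"

definition in_F :: "'a trigraph \<Rightarrow> bool" where
  "in_F T \<longleftrightarrow> berge T \<and> card (sw_components T) \<le> 1 \<and>
     (\<forall>C\<in>sw_components T.
        card (sw_edges_in T C) \<le> 2 \<and>
        (\<forall>x y. sw_edges_in T C = {{x, y}} \<longrightarrow> nbhd T x \<inter> nbhd T y = {}) \<and>
        (\<forall>v x y. x \<noteq> y \<and> sw_edges_in T C = {{v, x}, {v, y}} \<longrightarrow>
           (\<forall>w\<in>verts T - {v, x, y}. strongly_antiadj T v w) \<and>
           strongly_antiadj T x y \<and> nbhd T x \<inter> nbhd T y = {v}))"

definition favorable :: "'a trigraph \<Rightarrow> bool" where
  "favorable T \<longleftrightarrow> in_F T \<and> card (verts T) \<ge> 5 \<and>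
     (\<exists>u v. strongly_antiadj T u v \<and> u \<notin> swD T \<and> v \<notin> swD T) \<and>
     (\<forall>x y. x \<noteq> y \<and> swD T = {x, y} \<and> semiadj T x y \<longrightarrow>
        \<not> is_clique T (verts T - (swD T \<union> nbhd T x)) \<or>
        \<not> is_clique T (verts T - (swD T \<union> nbhd T y)))"

text \<open>The full realization is the line graph of a bipartite graph H: each vertex of T
is an edge (a, b) of H with a in the left part and b in the right part (both encoded by
naturals; H is simple, so the encoding is injective); two vertices are adjacent iff the
corresponding edges share an end.\<close>

definition line_graph_of_bipartite :: "'a trigraph \<Rightarrow> bool" where
  "line_graph_of_bipartite T \<longleftrightarrow> (\<exists>f :: 'a \<Rightarrow> nat \<times> nat. inj_on f (verts T) \<and>
     (\<forall>u\<in>verts T. \<forall>v\<in>verts T. u \<noteq> v \<longrightarrow>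
        (adj T u v \<longleftrightarrow> fst (f u) = fst (f v) \<or> snd (f u) = snd (f v))))"

definition line_trigraph :: "'a trigraph \<Rightarrow> bool" where
  "line_trigraph T \<longleftrightarrow> line_graph_of_bipartite T \<and>
     (\<forall>K. is_clique T K \<and> card K \<ge> 3 \<longrightarrow> is_strong_clique T K)"

end

theory Submission
  imports Defs
begin

text \<open>
  Let \<open>H\<close> be the bipartite root graph of the full realization. An odd prism of \<open>T\<close> is a theta of
  \<open>H\<close> (two vertices joined by three internally disjoint paths) whose branch vertices lie on the same
  side, and disjoint edges \<open>ab\<close>, \<open>cd\<close> with \<open>a\<close>, \<open>c\<close> on the same side form an even pair as soon
  as \<open>{a, c}\<close> separates \<open>b\<close> from \<open>d\<close> and \<open>{b, d}\<close> separates \<open>a\<close> from \<open>c\<close>. Switchable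
  pairs do no harm: they lie in no triangle, so a path can use one as a non-edge only if its two
  vertices are the ends of the path. If \<open>H\<close> has a theta, take a branch with at least three edges
  that is shortest possible: by the colour condition every detour from its interior would give a theta
  with a shorter branch, so the first four vertices of the branch give an even pair. If \<open>H\<close> has no
  theta, no cycle has an ear, and any four consecutive vertices of a cycle will do; in a forest, so will
  the ends of any path with at least three and an odd number of edges. The switchable component
  consists of edges at one or two vertices of degree two of \<open>H\<close>; these meet only one branch of a theta
  and are easily avoided, the exceptional case being a 4-cycle through them.
\<close>

subsection \<open>Thetas in bipartite graphs\<close>

lemma Int_insertD: "A \<inter> B = {p, q} \<Longrightarrow> x \<in> A \<Longrightarrow> x \<in> B \<Longrightarrow> x = p \<or> x = q"
  and Int_singletonD: "A \<inter> B = {p} \<Longrightarrow> x \<in> A \<Longrightarrow> x \<in> B \<Longrightarrow> x = p"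
  by auto

locale bipartite_graph =
  fixes E :: "'v \<Rightarrow> 'v \<Rightarrow> bool" and col :: "'v \<Rightarrow> bool"
  assumes sym: "E x y \<Longrightarrow> E y x" and proper: "E x y \<Longrightarrow> col x \<noteq> col y"
begin

definition apath :: "'v \<Rightarrow> 'v list \<Rightarrow> 'v \<Rightarrow> bool" where
  "apath x p y \<longleftrightarrow> p \<noteq> [] \<and> hd p = x \<and> last p = y \<and> distinct p \<and> successively E p"

definition cyc :: "'v list \<Rightarrow> bool" where
  "cyc p \<longleftrightarrow> length p \<ge> 3 \<and> distinct p \<and> successively E p \<and> E (last p) (hd p)"

text \<open>Two branches may both be the single edge \<open>pq\<close>. Such ends have different
  colours, so this degenerate case is compatible with the later colour condition on thetas.\<close>

definition theta_graph :: "'v \<Rightarrow> 'v \<Rightarrow> 'v list \<Rightarrow> 'v list \<Rightarrow> 'v list \<Rightarrow> bool" where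
  "theta_graph p q A B C \<longleftrightarrow> p \<noteq> q \<and> apath p A q \<and> apath p B q \<and> apath p C q \<and>
     set A \<inter> set B = {p, q} \<and> set A \<inter> set C = {p, q} \<and> set B \<inter> set C = {p, q}"

definition separated :: "'v set \<Rightarrow> 'v \<Rightarrow> 'v \<Rightarrow> bool" where
  "separated X x y \<longleftrightarrow> (\<forall>p. apath x p y \<longrightarrow> set p \<inter> X \<noteq> {})"

text \<open>This is the certificate for an even pair. An odd path of the trigraph from
  \<open>ab\<close> to \<open>cd\<close> becomes a root path joining ends of equal colour:
  \<open>a\<close> to \<open>c\<close> avoiding \<open>b\<close> and \<open>d\<close>, or
  \<open>b\<close> to \<open>d\<close> avoiding \<open>a\<close> and \<open>c\<close>. The two
  separations forbid both.\<close>

definition cross_separated :: "'v \<Rightarrow> 'v \<Rightarrow> 'v \<Rightarrow> 'v \<Rightarrow> bool" where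
  "cross_separated a b c d \<longleftrightarrow> E a b \<and> E c d \<and> a \<noteq> c \<and> b \<noteq> d \<and> col a = col c \<and>
     separated {a, c} b d \<and> separated {b, d} a c"

lemma edge_neq: "E x y \<Longrightarrow> x \<noteq> y"
  using proper by blast

lemma successively_rev_E: "successively E (rev p) \<longleftrightarrow> successively E p"
proof -
  have "(\<lambda>x y. E y x) = E" using sym by blast
  from arg_cong[OF this, of "\<lambda>F. successively F p"] show ?thesis
    unfolding successively_rev .
qed

lemma apath_rev: "apath x p y \<Longrightarrow> apath y (rev p) x"
  by (auto simp: apath_def successively_rev_E hd_rev last_rev simp del: successively_rev)

lemma apath_single: "apath x [x] x"
  by (simp add: apath_def)

lemma apath_ends: "apath x p y \<Longrightarrow> x \<in> set p" "apath x p y \<Longrightarrow> y \<in> set p"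
  by (auto simp: apath_def)

lemma apath_append:
  assumes "apath x P y" "apath y' Q z" "E y y'" "set P \<inter> set Q = {}"
  shows "apath x (P @ Q) z"
  using assms by (auto simp: apath_def successively_append_iff)

lemma apath_Cons: "apath y Q z \<Longrightarrow> E x y \<Longrightarrow> x \<notin> set Q \<Longrightarrow> apath x (x # Q) z"
  using apath_append[OF apath_single[of x]] by fastforce

lemma apath_snoc: "apath x P y \<Longrightarrow> E y z \<Longrightarrow> z \<notin> set P \<Longrightarrow> apath x (P @ [z]) z"
  using apath_append[OF _ apath_single[of z]] by fastforce

lemma apath_glue:
  assumes "apath x P y" "apath y Q z" "set P \<inter> set Q = {y}"
  shows "apath x (P @ tl Q) z" "set (P @ tl Q) = set P \<union> set Q"
    "length (P @ tl Q) + 1 = length P + length Q"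
proof -
  obtain Q' where Q: "Q = y # Q'" using assms(2) unfolding apath_def by (cases Q) auto
  have yP: "y \<in> set P" using apath_ends[OF assms(1)] by simp
  have "set P \<inter> set Q' = {}" using assms(2,3) Q by (auto simp: apath_def)
  then show "apath x (P @ tl Q) z"
    using assms(1,2) Q
    by (cases Q') (auto simp: apath_def successively_append_iff successively_Cons)
  show "set (P @ tl Q) = set P \<union> set Q" using Q yP by auto
  show "length (P @ tl Q) + 1 = length P + length Q" using Q by simp
qed

text \<open>Both ways of undoing the overlap at \<open>z\<close> are recorded because reversing the
  path turns the second into the first.\<close>

lemma apath_split:
  assumes "apath x P y" "z \<in> set P"
  obtains P1 P2 where "apath x P1 z" "apath z P2 y" "set P1 \<inter> set P2 = {z}"
    "set P1 \<union> set P2 = set P" "P = P1 @ tl P2" "P = butlast P1 @ P2"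
proof -
  obtain xs ys where P: "P = xs @ z # ys" using assms(2) by (auto simp: in_set_conv_decomp)
  have "apath x (xs @ [z]) z" "apath z (z # ys) y"
    using assms(1) P by (auto simp: apath_def successively_append_iff hd_append split: if_splits)
  moreover have "set (xs @ [z]) \<inter> set (z # ys) = {z}"
    using assms(1) P by (auto simp: apath_def)
  ultimately show thesis using that[of "xs @ [z]" "z # ys"] P by auto
qed

text \<open>Cutting a path at its first vertex in \<open>Z\<close> is how ears arise. If
  \<open>b\<close> is in \<open>Z\<close>, the result is just \<open>[b]\<close>; for a proper ear,
  \<open>Z\<close> must not contain the starting vertex.\<close>

lemma apath_first_hit:
  assumes "apath b Q d" "d \<in> Z"
  obtains S z where "apath b S z" "set S \<inter> Z = {z}" "set S \<subseteq> set Q"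
proof -
  have "\<exists>x\<in>set Q. x \<in> Z" using assms apath_ends by blast
  then obtain xs z ys where Q: "Q = xs @ z # ys" "z \<in> Z" "\<forall>x\<in>set xs. x \<notin> Z"
    by (rule split_list_first_propE)
  have "apath b (xs @ [z]) z"
    using assms(1) Q by (auto simp: apath_def successively_append_iff hd_append split: if_splits)
  then show thesis using that[of "xs @ [z]" z] Q by auto
qed

lemma apath_length2: "apath x p y \<Longrightarrow> x \<noteq> y \<Longrightarrow> length p \<ge> 2"
  by (cases p rule: remdups_adj.cases) (auto simp: apath_def)

lemma apath_parity: "apath x p y \<Longrightarrow> col x = col y \<longleftrightarrow> odd (length p)"
proof (induction p arbitrary: x)
  case (Cons a p)
  show ?case
  proof (cases p)
    case Nil
    then show ?thesis using Cons.prems by (auto simp: apath_def)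
  next
    case (Cons b p')
    then have "apath b p y" "E x b" using Cons.prems by (auto simp: apath_def)
    then show ?thesis using Cons.IH[of b] proper[of x b] by auto
  qed
qed (simp add: apath_def)

lemma separated_sym: "separated X x y \<Longrightarrow> separated X y x"
  unfolding separated_def using apath_rev[of y _ x] by fastforce

lemma theta_rev: "theta_graph p q A B C \<Longrightarrow> theta_graph q p (rev A) (rev B) (rev C)"
  unfolding theta_graph_def set_rev using apath_rev[of p _ q] by (auto simp: insert_commute[of q p])

lemma theta_perm:
  "theta_graph p q A B C \<Longrightarrow> theta_graph p q B A C"
  "theta_graph p q A B C \<Longrightarrow> theta_graph p q A C B"
  unfolding theta_graph_def Int_commute[of "set B" "set A"] Int_commute[of "set C" "set B"]
    by simp_all

section \<open>Rerouting a theta through a detour\<close>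

text \<open>The detour \<open>S\<close> runs from the interior of \<open>A\<close> to the interior
  of \<open>B\<close>. The new branches from \<open>b\<close> to \<open>p\<close> are
  \<open>A\<close> backwards, \<open>S\<close> followed by \<open>B\<close> backwards, and the rest
  of \<open>A\<close> up to \<open>q\<close> followed by \<open>C\<close> backwards.\<close>

lemma theta_divert_other:
  assumes "theta_graph p q A B C" "b \<in> set A" "b \<noteq> p" "b \<noteq> q"
    and "apath b S z" "set S \<inter> (set A \<union> set B \<union> set C) = {b, z}"
    and "z \<in> set B" "z \<noteq> p" "z \<noteq> q"
  shows "\<exists>A' B' C'. theta_graph b p A' B' C'"
proof -
  have t: "apath p A q" "apath p B q" "apath p C q" "p \<noteq> q"
     "set A \<inter> set B = {p, q}" "set A \<inter> set C = {p, q}" "set B \<inter> set C = {p, q}"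
    using assms(1) by (auto simp: theta_graph_def)
  obtain A1 A2 where A: "apath p A1 b" "apath b A2 q" "set A1 \<inter> set A2 = {b}"
    "set A1 \<union> set A2 = set A"
    using apath_split[OF t(1) assms(2)] by metis
  obtain B1 B2 where B: "apath p B1 z" "apath z B2 q" "set B1 \<inter> set B2 = {z}"
    "set B1 \<union> set B2 = set B"
    using apath_split[OF t(2) assms(7)] by metis
  note ends = apath_ends[OF A(1)] apath_ends[OF A(2)] apath_ends[OF B(1)] apath_ends[OF B(2)]
    apath_ends[OF t(1)]  apath_ends[OF t(2)]  apath_ends[OF t(3)] apath_ends[OF assms(5)]
  have sub: "\<And>x. x \<in> set A1 \<Longrightarrow> x \<in> set A" "\<And>x. x \<in> set A2 \<Longrightarrow> x \<in> set A"
    "\<And>x. x \<in> set B1 \<Longrightarrow> x \<in> set B" using A B by auto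
  have q: "q \<notin> set A1" using A(3) ends assms(4) by auto
  have p: "p \<notin> set A2" using A(3) ends assms(3) by auto
  have q': "q \<notin> set B1" using B(3) ends assms(9) by auto
  note T = Int_insertD[OF t(5)] Int_insertD[OF t(6)] Int_insertD[OF t(7)] Int_singletonD[OF A(3)]
  have bz: "b \<notin> set B" "b \<notin> set C" "z \<notin> set A" "z \<notin> set C"
    using assms(2-4,7-9) T(1-3) by blast+
  have "x = b \<or> x = z" if "x \<in> set S" "x \<in> set A \<or> x \<in> set B \<or> x \<in> set C" for x
    using Int_insertD[OF assms(6)] that by auto
  then have S: "\<And>x. x \<in> set S \<Longrightarrow> x \<in> set A \<Longrightarrow> x = b" "\<And>x. x \<in> set S \<Longrightarrow> x \<in> set B \<Longrightarrow> x = z"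
    "\<And>x. x \<in> set S \<Longrightarrow> x \<in> set C \<Longrightarrow> False"
    using bz by blast+
  have i1: "set S \<inter> set (rev B1) = {z}" unfolding set_rev using ends S sub by blast
  have i2: "set A2 \<inter> set (rev C) = {q}" unfolding set_rev using sub T p ends by blast
  note g1 = apath_glue[OF assms(5) apath_rev[OF B(1)] i1]
  note g2 = apath_glue[OF A(2) apath_rev[OF t(3)] i2]
  have s1: "set A1 \<inter> (set S \<union> set B1) = {b, p}"
    using q ends bz by (auto dest: sub T S)
  have s2: "set A1 \<inter> (set A2 \<union> set C) = {b, p}"
    using sub T q ends by blast
  have s3: "(set S \<union> set B1) \<inter> (set A2 \<union> set C) = {b, p}"
    using q' ends p by (auto dest: sub T S)
  have "theta_graph b p (rev A1) (S @ tl (rev B1)) (A2 @ tl (rev C))"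
    unfolding theta_graph_def g1(2) g2(2) set_rev
    using g1(1) g2(1) apath_rev[OF A(1)] assms(3) s1 s2 s3 by blast
  then show ?thesis by blast
qed

text \<open>The new branches are the segment of \<open>A\<close> between \<open>b\<close> and
  \<open>z\<close>, the detour \<open>S\<close>, and the way round: from \<open>b\<close> back to
  \<open>p\<close>, along \<open>B\<close> to \<open>q\<close> and back along \<open>A\<close> to
  \<open>z\<close>. The first is shorter than \<open>A\<close> since it misses \<open>p\<close>, and
  it is a single edge only if \<open>bz\<close> is an edge of \<open>A\<close>.\<close>

lemma theta_divert_forward:
  assumes "theta_graph p q A B C" "b \<noteq> p" "b \<noteq> q"
    and A: "apath p A1 b" "apath b A2 q" "set A1 \<inter> set A2 = {b}" "set A1 \<union> set A2 = set A"
      "A = A1 @ tl A2"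
    and S: "apath b S z" "set S \<inter> (set A \<union> set B \<union> set C) = {b, z}" "z \<noteq> b" and z: "z \<in> set A2"
  shows "\<exists>A' B'. theta_graph b z A' S B' \<and> set A' \<subseteq> set A \<and> length A' < length A \<and>
           (length A' = 2 \<longrightarrow> (\<exists>xs ys. A = xs @ b # z # ys))"
proof -
  have t: "apath p A q" "apath p B q" "apath p C q" "p \<noteq> q"
     "set A \<inter> set B = {p, q}" "set A \<inter> set C = {p, q}" "set B \<inter> set C = {p, q}"
    using assms(1) by (auto simp: theta_graph_def)
  obtain A3 A4 where A': "apath b A3 z" "apath z A4 q" "set A3 \<inter> set A4 = {z}"
    "set A3 \<union> set A4 = set A2"
      "A2 = A3 @ tl A4"
    using apath_split[OF A(2) z] by metis
  note ends = apath_ends[OF A(1)] apath_ends[OF A(2)] apath_ends[OF A'(1)] apath_ends[OF A'(2)]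
    apath_ends[OF t(1)] apath_ends[OF t(2)] apath_ends[OF t(3)] apath_ends[OF S(1)]
  note T = Int_insertD[OF t(5)] Int_insertD[OF t(6)] Int_singletonD[OF A(3)] Int_singletonD[OF A'(3)]
  have sub: "\<And>x. x \<in> set A1 \<Longrightarrow> x \<in> set A" "\<And>x. x \<in> set A2 \<Longrightarrow> x \<in> set A"
    "\<And>x. x \<in> set A3 \<Longrightarrow> x \<in> set A2" "\<And>x. x \<in> set A4 \<Longrightarrow> x \<in> set A2"
    using A A' by auto
  have SD: "x = b \<or> x = z" if "x \<in> set S" "x \<in> set A \<or> x \<in> set B" for x
    using Int_insertD[OF S(2)] that by auto
  have q: "q \<notin> set A1" using T(3) ends assms(3) by blast
  have p: "p \<notin> set A2" using T(3) ends assms(2) by blast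
  have b: "b \<notin> set B" "b \<notin> set A4" using ends assms(2,3) S(3) by (auto dest: sub T)
  have zA1: "z \<notin> set A1" using T z S(3) by blast
  have i1: "set (rev A1) \<inter> set B = {p}" unfolding set_rev using ends q by (auto dest: sub T)
  note g1 = apath_glue[OF apath_rev[OF A(1)] t(2) i1]
  have i2: "set (rev A1 @ tl B) \<inter> set (rev A4) = {q}" unfolding g1(2) set_rev
    using ends p b by (auto dest: sub T)
  note g2 = apath_glue[OF g1(1) apath_rev[OF A'(2)] i2]
  let ?B = "(rev A1 @ tl B) @ tl (rev A4)"
  have sB: "set ?B = set A1 \<union> set B \<union> set A4" unfolding g2(2) g1(2) by simp
  have s1: "set A3 \<inter> set S = {b, z}" using ends by (auto dest: sub SD)
  have s2: "set A3 \<inter> set ?B = {b, z}" unfolding sB using ends p by (auto dest: sub T)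
  have s3: "set S \<inter> set ?B = {b, z}" unfolding sB using ends by (auto dest: sub SD)
  have "theta_graph b z A3 S ?B"
    unfolding theta_graph_def using S A' s1 s2 s3 g2(1) by blast
  moreover have "set A3 \<subseteq> set A" using sub by blast
  moreover have "length A3 < length A"
  proof -
    have "length A1 \<ge> 2" using apath_length2[OF A(1)] assms(2) by simp
    then show ?thesis using A(5) A'(5) by auto
  qed
  moreover have "\<exists>xs ys. A = xs @ b # z # ys" if "length A3 = 2"
  proof -
    have "A3 = [b, z]" using A'(1) that unfolding apath_def
      by (cases A3 rule: remdups_adj.cases) auto
    moreover have "A1 = butlast A1 @ [b]" using A(1) unfolding apath_def
      by (metis append_butlast_last_id)
    ultimately have "A = butlast A1 @ b # z # tl A4" using A(5) A'(5)
      by (metis append.assoc append_Cons append_Nil list.sel(3))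
    then show ?thesis by blast
  qed
  ultimately show ?thesis by blast
qed

lemma theta_divert_same:
  assumes "theta_graph p q A B C" "b \<in> set A" "b \<noteq> p" "b \<noteq> q"
    and S: "apath b S z" "set S \<inter> (set A \<union> set B \<union> set C) = {b, z}" "z \<noteq> b" and z: "z \<in> set A"
  shows "\<exists>A' B'. theta_graph b z A' S B' \<and> set A' \<subseteq> set A \<and> length A' < length A \<and>
           (length A' = 2 \<longrightarrow> (\<exists>xs ys. A = xs @ b # z # ys \<or> A = xs @ z # b # ys))"
proof -
  have t: "apath p A q" using assms(1) by (auto simp: theta_graph_def)
  obtain A1 A2 where A: "apath p A1 b" "apath b A2 q" "set A1 \<inter> set A2 = {b}"
    "set A1 \<union> set A2 = set A"
      "A = A1 @ tl A2" "A = butlast A1 @ A2"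
    using apath_split[OF t assms(2)] by metis
  show ?thesis
  proof (cases "z \<in> set A2")
    case True
    then show ?thesis using theta_divert_forward[OF assms(1,3,4) A(1-5) S True] by blast
  next
    case False
    \<comment> \<open>A return before \<open>b\<close> is a return after \<open>b\<close> in the
      reversed theta.\<close>
    then have z1: "z \<in> set (rev A1)" using z A(4) by auto
    have 1: "rev A = rev A2 @ tl (rev A1)" using A(6)
      by (metis rev_append butlast_rev rev_rev_ident)
    have 2: "set (rev A2) \<inter> set (rev A1) = {b}" "set (rev A2) \<union> set (rev A1) = set (rev A)"
       "set S \<inter> (set (rev A) \<union> set (rev B) \<union> set (rev C)) = {b, z}" using A S by auto
    obtain A' B' where 3: "theta_graph b z A' S B'" "set A' \<subseteq> set (rev A)"
      "length A' < length (rev A)"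
        and 4: "length A' = 2 \<longrightarrow> (\<exists>xs ys. rev A = xs @ b # z # ys)"
      using theta_divert_forward[OF theta_rev[OF assms(1)] assms(4,3) apath_rev[OF A(2)]
        apath_rev[OF A(1)] 2(1,2) 1 S(1) 2(3) S(3) z1]
      by blast
    have "\<exists>xs ys. A = xs @ z # b # ys" if r: "rev A = xs @ b # z # ys" for xs ys
    proof -
      have "A = rev ys @ z # b # rev xs" using arg_cong[OF r, of rev] by simp
      then show ?thesis by blast
    qed
    with 3 4 show ?thesis by (metis set_rev length_rev)
  qed
qed

lemma apath_interior_nbrs:
  assumes "apath x P y" "z \<in> set P" "z \<noteq> x" "z \<noteq> y"
  obtains L s r R where "P = L @ [s, z, r] @ R" "E s z" "E z r" "s \<noteq> r"
proof -
  obtain xs ys where P: "P = xs @ z # ys" using assms(2) by (auto simp: in_set_conv_decomp)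
  have "xs \<noteq> []" "ys \<noteq> []" using assms P by (auto simp: apath_def)
  then obtain L s r R where "xs = L @ [s]" "ys = r # R" by (metis rev_exhaust list.exhaust)
  then show thesis using that[of L s r R] assms P by (auto simp: apath_def successively_append_iff)
qed

lemma cyc_rotate: "cyc (xs @ ys) \<Longrightarrow> cyc (ys @ xs)"
  by (cases "xs = []"; cases "ys = []") (auto simp: cyc_def successively_append_iff)

lemma cyc_rev: "cyc xs \<Longrightarrow> cyc (rev xs)"
  by (auto simp: cyc_def successively_rev_E hd_rev last_rev sym simp del: successively_rev)

lemma cyc_even: "cyc xs \<Longrightarrow> even (length xs)"
proof -
  assume c: "cyc xs"
  then have "apath (hd xs) xs (last xs)" by (auto simp: cyc_def apath_def)
  then show ?thesis using apath_parity proper c unfolding cyc_def by metis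
qed

end

section \<open>Graphs whose thetas have branch vertices of different colours\<close>

locale even_theta_free = bipartite_graph +
  assumes theta_col: "theta_graph p q A B C \<Longrightarrow> col p \<noteq> col q"
begin

text \<open>A detour ending inside another branch would give thetas with branch vertices
  \<open>b\<close>, \<open>p\<close> and \<open>b\<close>, \<open>q\<close>, so \<open>b\<close>
  would differ in colour from both; but \<open>p\<close> and \<open>q\<close> themselves differ in
  colour. Hence the detour returns to \<open>A\<close>.\<close>

lemma theta_detour:
  assumes "theta_graph p q A B C" "b \<in> set A" "b \<noteq> p" "b \<noteq> q"
    and S: "apath b S z" "set S \<inter> (set A \<union> set B \<union> set C) = {b, z}" "z \<noteq> b"
  shows "\<exists>A' B'. theta_graph b z A' S B' \<and> set A' \<subseteq> set A \<and> length A' < length A \<and>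
           (length A' = 2 \<longrightarrow> (\<exists>xs ys. A = xs @ b # z # ys \<or> A = xs @ z # b # ys))"
proof -
  have "z \<in> set A"
  proof (rule ccontr)
    assume n: "z \<notin> set A"
    have zBC: "z \<in> set B \<or> z \<in> set C" using S(2) n by blast
    have pq: "p \<in> set A" "q \<in> set A" using assms(1) by (auto simp: theta_graph_def)
    then have zpq: "z \<noteq> p" "z \<noteq> q" using n by auto
    \<comment> \<open>Stated for arbitrary roles so that it covers both \<open>B\<close> and
      \<open>C\<close> as the branch in which the detour ends.\<close>
    have *: "col b \<noteq> col p' \<and> col b \<noteq> col q'"
      if th: "theta_graph p' q' A B' C'" and zB: "z \<in> set B'" and pq': "b \<noteq> p'" "b \<noteq> q'" "z \<noteq> p'"
        "z \<noteq> q'"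
         and S': "set S \<inter> (set A \<union> set B' \<union> set C') = {b, z}" for p' q' B' C'
      using theta_divert_other[OF th assms(2) pq'(1,2) S(1) S' zB pq'(3,4)]
        theta_divert_other[OF theta_rev[OF th] _ pq'(2,1) S(1) _ _ pq'(4,3)] assms(2) S' zB theta_col
      by (metis set_rev)
    have "set S \<inter> (set A \<union> set C \<union> set B) = {b, z}" using S(2) by (simp add: Un_ac)
    then have "col b \<noteq> col p \<and> col b \<noteq> col q"
      using *[of p q B C] *[of p q C B] zBC assms(1,3,4) zpq S(2) theta_perm(2) by blast
    then show False using theta_col[OF assms(1)] by auto
  qed
  then show ?thesis using theta_divert_same[OF assms] by blast
qed

lemma consecutive_unique:
  assumes "distinct A" "A = xs @ b # z # ys" "A ! i = b" "Suc i < length A"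
  shows "z = A ! Suc i"
proof -
  have "A ! length xs = b" using assms(2) by simp
  then have "i = length xs" using assms nth_eq_iff_index_eq[of A i "length xs"] by simp
  then show ?thesis using assms(2) by (simp add: nth_append)
qed

lemma consecutive_unique':
  assumes "distinct A" "A = xs @ z # b # ys" "A ! Suc i = b" "Suc i < length A"
  shows "z = A ! i"
proof -
  have "A ! Suc (length xs) = b" using assms(2) by (simp add: nth_append)
  then have "Suc i = Suc (length xs)"
    using assms nth_eq_iff_index_eq[of A "Suc i" "Suc (length xs)"] by simp
  then show ?thesis using assms(2) by simp
qed

text \<open>Strong induction replaces the choice of a shortest branch. A failed separation yields a
  theta whose branch \<open>A'\<close> is shorter, again has at least four vertices, and lies inside
  \<open>set A\<close>, so it still avoids \<open>W\<close>.\<close>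

lemma theta_cross_separated:
  assumes "theta_graph p q A B C" "length A \<ge> 4" "set A \<inter> W = {}"
  shows "\<exists>a b c d. cross_separated a b c d \<and> {a, b, c, d} \<inter> W = {}"
  using assms
proof (induction "length A" arbitrary: p q A B C rule: less_induct)
  case less
  obtain a b c d r where A: "A = a # b # c # d # r"
    using less.prems(2) by (auto simp: numeral_eq_Suc Suc_le_length_iff)
  have ap: "apath p A q" and ne: "p \<noteq> q" using less.prems(1) by (auto simp: theta_graph_def)
  then have p: "p = a" and q: "q = last (d # r)" and dA: "distinct A"
    and e: "E a b" "E b c" "E c d" using A by (auto simp: apath_def)
  have neqs: "b \<noteq> p" "b \<noteq> q" "c \<noteq> p" "c \<noteq> q" "b \<in> set A" "c \<in> set A" "d \<in> set A" "a \<in> set A"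
    using p q dA A by (auto split: if_splits)
  have "col a = col c" using e proper by blast
  \<comment> \<open>Both possible failures are treated at once: \<open>x\<close> is \<open>b\<close>
    or \<open>c\<close>, \<open>l\<close> and \<open>r'\<close> are its neighbours on
    \<open>A\<close>, and \<open>Q\<close> leads from \<open>x\<close> back to \<open>A\<close> and
    avoids them.\<close>
  have step: ?case
    if x: "x \<in> set A" "x \<noteq> p" "x \<noteq> q" and Q: "apath x Q y" "y \<in> set A" "y \<noteq> x"
      "set Q \<inter> {l, r'} = {}"
      and con: "\<And>xs ys z. A = xs @ x # z # ys \<Longrightarrow> z = r'" "\<And>xs ys z. A = xs @ z # x # ys \<Longrightarrow> z = l"
    for x y Q l r'
  proof -
    let ?Z = "(set A \<union> set B \<union> set C) - {x}"
    obtain S z where S: "apath x S z" "set S \<inter> ?Z = {z}" "set S \<subseteq> set Q"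
      using apath_first_hit[OF Q(1), of ?Z] Q(2,3) by blast
    have "x \<in> set S" using S(1) apath_ends by blast
    then have S2: "set S \<inter> (set A \<union> set B \<union> set C) = {x, z}" using S(2) x(1) by blast
    have zx: "z \<noteq> x" and "z \<in> set Q" using S by blast+
    then have zn: "z \<noteq> l" "z \<noteq> r'" using Q(4) by auto
    obtain A' B' where T: "theta_graph x z A' S B'" "set A' \<subseteq> set A" "length A' < length A"
       "length A' = 2 \<longrightarrow> (\<exists>xs ys. A = xs @ x # z # ys \<or> A = xs @ z # x # ys)"
      using theta_detour[OF less.prems(1) x S(1) S2 zx] by blast
    \<comment> \<open>Two vertices would make \<open>z\<close> a neighbour of \<open>x\<close> on
      \<open>A\<close>; three are excluded by parity.\<close>
    have "length A' \<noteq> 2" using T(4) con zn by blast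
    moreover have "even (length A')" using apath_parity theta_col[OF T(1)] T(1)
      unfolding theta_graph_def by blast
    moreover have "length A' \<ge> 2" using apath_length2 T(1) unfolding theta_graph_def by blast
    ultimately have "length A' \<ge> 4" by presburger
    then show ?case using less.hyps[OF T(3,1)] T(2) less.prems(3) by blast
  qed
  show ?case
  proof (rule ccontr)
    assume n: "\<not> ?case"
    have "{a, b, c, d} \<inter> W = {}" using less.prems(3) A by auto
    then have "\<not> cross_separated a b c d" using n by blast
    then have "\<not> separated {a, c} b d \<or> \<not> separated {b, d} a c"
      using e \<open>col a = col c\<close> dA A unfolding cross_separated_def by auto
    then show False
    proof
      assume "\<not> separated {a, c} b d"
      then obtain Q where Q: "apath b Q d" "set Q \<inter> {a, c} = {}" unfolding separated_def by blast
      show False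
      proof (rule notE[OF n], rule step[of b Q d a c])
        show "z = c" if "A = xs @ b # z # ys" for xs ys z
          using consecutive_unique[OF dA that, of 1] A by simp
        show "z = a" if "A = xs @ z # b # ys" for xs ys z
          using consecutive_unique'[OF dA that, of 0] A by simp
      qed (use neqs Q A dA in auto)
    next
      assume "\<not> separated {b, d} a c"
      \<comment> \<open>The path is read from \<open>c\<close>, because a detour must start in the
        interior of the branch and \<open>a\<close> is the branch vertex \<open>p\<close>.\<close>
      then obtain Q where Q: "apath c Q a" "set Q \<inter> {b, d} = {}" unfolding separated_def
        using apath_rev by (metis set_rev)
      show False
      proof (rule notE[OF n], rule step[of c Q a b d])
        show "z = d" if "A = xs @ c # z # ys" for xs ys z
          using consecutive_unique[OF dA that, of 2] A by simp
        show "z = b" if "A = xs @ z # c # ys" for xs ys z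
          using consecutive_unique'[OF dA that, of 1] A by simp
      qed (use neqs Q A dA in auto)
    qed
  qed
qed

lemma apath_snoc_obtain:
  assumes "apath x P y" "length P \<ge> 3"
  obtains L u v where "P = L @ [u, v, y]" "E u v" "E v y" "u \<noteq> y"
proof -
  have "length (rev P) \<ge> 3" using assms(2) by simp
  then obtain L u v z where "rev P = z # v # u # L"
    by (auto simp: numeral_eq_Suc Suc_le_length_iff simp del: length_rev)
  then have P: "P = rev L @ [u, v, z]"
    by (metis append.assoc append_Cons append_Nil rev.simps(2) rev_rev_ident)
  then show thesis using that[of "rev L" u v] P assms(1)
    by (auto simp: apath_def successively_append_iff)
qed

text \<open>A violating path, followed backwards from \<open>q\<close> to its first vertex
  \<open>z\<close> on \<open>P\<close> and then along \<open>P\<close> to \<open>last P\<close>,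
  closes to a cycle with the edge from \<open>last P\<close> to \<open>q\<close>.\<close>

lemma forest_separated:
  assumes nc: "\<And>P. \<not> cyc P" and P: "apath p (p # P @ [q]) q" "length P \<ge> 2"
  shows "separated {p, last P} (hd P) q"
  unfolding separated_def
proof (intro allI impI notI)
  fix Q assume Q: "apath (hd P) Q q" "set Q \<inter> {p, last P} = {}"
  have ne: "P \<noteq> []" using P(2) by auto
  have aP: "apath (hd P) P (last P)" and Eq: "E (last P) q" and qP: "q \<notin> set P"
    using P(1) ne by (auto simp: apath_def successively_append_iff successively_Cons)
  obtain S z where S: "apath q S z" "set S \<inter> set P = {z}" "set S \<subseteq> set (rev Q)"
    using apath_first_hit[OF apath_rev[OF Q(1)], of "set P"] ne by auto
  have z: "z \<in> set P" "z \<noteq> last P" using S Q(2) apath_ends(2)[OF S(1)] by auto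
  obtain P1 P2 where P2: "apath z P2 (last P)" "set P1 \<union> set P2 = set P"
    using apath_split[OF aP z(1)] by metis
  have i: "set S \<inter> set P2 = {z}" using S(2) P2 apath_ends(1)[OF P2(1)] by auto
  note g = apath_glue[OF S(1) P2(1) i]
  have "length S \<ge> 2" "length P2 \<ge> 2" using apath_length2 S(1) P2(1) z qP by blast+
  then have "length (S @ tl P2) \<ge> 3" by simp
  then have "cyc (S @ tl P2)" using g(1) Eq unfolding cyc_def apath_def by simp
  then show False using nc by blast
qed

text \<open>The second separation is the first one for the reversed path.\<close>

lemma forest_cross_separated:
  assumes nc: "\<And>P. \<not> cyc P" and P: "apath p (p # P @ [q]) q" "length P \<ge> 2" and col:
    "col p = col (last P)"
  shows "cross_separated p (hd P) (last P) q"
proof -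
  have ne: "P \<noteq> []" using P(2) by auto
  have rv: "apath q (q # rev P @ [p]) p" using apath_rev[OF P(1)] by simp
  have "separated {q, hd P} (last P) p"
    using forest_separated[OF nc rv] P(2) ne by (simp add: hd_rev last_rev)
  then have "separated {hd P, q} p (last P)" using separated_sym by (metis insert_commute)
  moreover have "separated {p, last P} (hd P) q" using forest_separated[OF nc P] .
  moreover have "E p (hd P)" "E (last P) q" "p \<noteq> last P" "hd P \<noteq> q"
    using P(1) ne by (auto simp: apath_def successively_append_iff successively_Cons)
  ultimately show ?thesis using col unfolding cross_separated_def by blast
qed

end

subsection \<open>Avoiding vertices of degree two\<close>

text \<open>\<open>W\<close> holds the vertices of degree two where switchable edges meet: \<open>W = {w}\<close> for a small
  component and \<open>W = {w, v}\<close> for a light one. In the small case the given disjoint edges also have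
  to avoid the neighbour \<open>v\<close> of \<open>w\<close>, by the third condition of favorability. For \<open>W = {}\<close> the vertices
  \<open>w\<close>, \<open>v\<close>, \<open>t\<close> are irrelevant.\<close>

locale counterexample = even_theta_free +
  fixes W :: "'a set" and w v t :: 'a and e1 e2 f1 f2 :: 'a
  assumes W: "W \<noteq> {} \<Longrightarrow> w \<in> W" "W \<subseteq> {w, v}"
    and w_nbrs: "W \<noteq> {} \<Longrightarrow> v \<noteq> t" "W \<noteq> {} \<Longrightarrow> E w y \<longleftrightarrow> y = v \<or> y = t"
    and v_nbrs: "v \<in> W \<Longrightarrow> \<exists>t'. \<forall>y. E v y \<longleftrightarrow> y = w \<or> y = t'"
    and e: "E e1 e2" and f: "E f1 f2" and ef: "{e1, e2} \<inter> {f1, f2} = {}"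
    and ef_avoid: "W \<noteq> {} \<Longrightarrow> {e1, e2, f1, f2} \<inter> {w, v} = {}"
    and no_cross_separated: "cross_separated p q r s \<Longrightarrow> {p, q, r, s} \<inter> W \<noteq> {}"
begin

lemma W_degree:
  assumes "x \<in> W" "E x y1" "E x y2" "E x y3" shows "y1 = y2 \<or> y1 = y3 \<or> y2 = y3"
proof (cases "x = w")
  case True
  have ne: "W \<noteq> {}" using assms(1) by auto
  show ?thesis using assms(2-4) unfolding True w_nbrs(2)[OF ne] by blast
next
  case False
  then have "v \<in> W" "x = v" using assms(1) W(2) by auto
  then obtain t' where t': "\<And>y. E v y \<longleftrightarrow> y = w \<or> y = t'" using v_nbrs by blast
  show ?thesis using assms(2-4) unfolding \<open>x = v\<close> t' by blast
qed

lemma v_nbr_w: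
  assumes "v \<in> W" "E v y1" "E v y2" "y1 \<noteq> y2" shows "y1 = w \<or> y2 = w"
  using v_nbrs[OF assms(1)] assms(2-4) by blast

text \<open>By \<open>theta_cross_separated\<close> both long branches meet \<open>W\<close>, and
  they do so in interior vertices because the branch vertices have three neighbours. So one contains
  \<open>w\<close> and the other \<open>v\<close>; these are adjacent, which gives a vertex of
  \<open>W\<close> a third neighbour.\<close>

lemma theta_short:
  assumes th: "theta_graph p q A B C" and "length A \<ge> 4" "length B \<ge> 4"
  shows False
proof -
  \<comment> \<open>With two long branches the second vertices of \<open>A'\<close> and
    \<open>B'\<close> are interior, so the three second vertices are distinct neighbours of
    \<open>p'\<close>.\<close>
  have end_notin: "p' \<notin> W" if th': "theta_graph p' q' A' B' C'" and lA: "length A' \<ge> 4" and lB: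
    "length B' \<ge> 4" for p' q' A' B' C'
  proof
    assume pW: "p' \<in> W"
    note t = th'[unfolded theta_graph_def]
    obtain a1 a2 Ar where A: "A' = a1 # a2 # Ar" "Ar \<noteq> []" using lA
      by (auto simp: numeral_eq_Suc Suc_le_length_iff)
    obtain b1 b2 Br where B: "B' = b1 # b2 # Br" "Br \<noteq> []" using lB
      by (auto simp: numeral_eq_Suc Suc_le_length_iff)
    have "length C' \<ge> 2" using apath_length2 t by blast
    then obtain c1 c2 Cr where C: "C' = c1 # c2 # Cr"
      by (auto simp: numeral_eq_Suc Suc_le_length_iff)
    have ap: "apath p' A' q'" "apath p' B' q'" "apath p' C' q'" using t by blast+
    then have Es: "E p' a2" "E p' b2" "E p' c2" using A B C unfolding apath_def by auto
    have n: "a2 \<noteq> p'" "a2 \<noteq> q'" "b2 \<noteq> p'" "b2 \<noteq> q'"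
      using ap(1,2) A B last_in_set unfolding apath_def by fastforce+
    have in3: "a2 \<in> set A'" "b2 \<in> set B'" "c2 \<in> set C'" using A B C by auto
    have "a2 \<noteq> b2" "a2 \<noteq> c2" "b2 \<noteq> c2" using t n in3 by (metis IntI insertE singletonD)+
    then show False using W_degree[OF pW Es] by blast
  qed
  have p: "p \<notin> W" using end_notin[OF assms] .
  have q: "q \<notin> W" using end_notin[OF theta_rev[OF th]] assms by simp
  have hit: "\<exists>x. x \<in> set A' \<and> x \<in> W" if "theta_graph p q A' B' C'" "length A' \<ge> 4" for A' B' C'
    using theta_cross_separated[OF that, of W] no_cross_separated by blast
  obtain x where x: "x \<in> set A" "x \<in> W" using hit[OF th assms(2)] by blast
  obtain y where y: "y \<in> set B" "y \<in> W" using hit[OF theta_perm(1)[OF th] assms(3)] by blast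
  have t: "apath p A q" "set A \<inter> set B = {p, q}" using th by (auto simp: theta_graph_def)
  have "x \<noteq> p" "x \<noteq> q" "y \<noteq> p" "y \<noteq> q" using p q x y by auto
  then have yA: "y \<notin> set A" and "x \<noteq> y" using Int_insertD[OF t(2)] y x by blast+
  then have "W \<noteq> {}" "(x = w \<and> y = v) \<or> (x = v \<and> y = w)" using x y W(2) by auto
  then have Exy: "E x y" using w_nbrs(2) sym by blast
  obtain L s r R where sr: "A = L @ [s, x, r] @ R" "E s x" "E x r" "s \<noteq> r"
    using apath_interior_nbrs[OF t(1) x(1) \<open>x \<noteq> p\<close> \<open>x \<noteq> q\<close>] .
  have "s \<noteq> y" "r \<noteq> y" using sr(1) yA by auto
  then show False using W_degree[OF x(2) sym[OF sr(2)] sr(3) Exy] sr(4) by blast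
qed

section \<open>Ears of cycles\<close>

text \<open>The ear \<open>S\<close> turns the cycle formed by \<open>P\<close> and the edge
  \<open>ab\<close> into a theta with two long branches, which \<open>theta_short\<close> forbids.
  The hypothesis \<open>ne\<close> excludes only a single edge to a cycle neighbour of
  \<open>b\<close>, which adds nothing to the cycle.\<close>

lemma no_ear:
  assumes P: "apath b P a" "E a b" "length P \<ge> 3"
    and S: "apath b S z" "set S \<inter> set P = {b, z}" "z \<noteq> b"
    and ne: "length S \<ge> 3 \<or> (z \<noteq> a \<and> z \<noteq> P ! 1)"
  shows False
proof -
  have "z \<in> set P" using S(2) by auto
  then obtain P1 P2 where P': "apath b P1 z" "apath z P2 a" "set P1 \<inter> set P2 = {z}"
    "set P1 \<union> set P2 = set P" "P = P1 @ tl P2"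
    using apath_split[OF P(1)] by metis
  have bP2: "b \<notin> set P2" using Int_singletonD[OF P'(3)] apath_ends[OF P'(1)] S(3) by blast
  have aP: "apath b (b # rev P2) z" using apath_Cons[OF apath_rev[OF P'(2)] sym[OF P(2)]] bP2
    by simp
  have zin: "z \<in> set P1" "z \<in> set P2" "b \<in> set P1" "b \<in> set S" "z \<in> set S"
    using apath_ends P' S(1) by blast+
  have i1: "set P1 \<inter> set (b # rev P2) = {b, z}" using zin by (auto dest: Int_singletonD[OF P'(3)])
  have sub: "\<And>x. x \<in> set P1 \<Longrightarrow> x \<in> set P" "\<And>x. x \<in> set P2 \<Longrightarrow> x \<in> set P" using P'(4) by auto
  have i2: "set P1 \<inter> set S = {b, z}" "set (b # rev P2) \<inter> set S = {b, z}" using zin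
    by (auto dest: sub Int_insertD[OF S(2)])
  have th: "theta_graph b z P1 (b # rev P2) S"
    unfolding theta_graph_def using S(1,3) P'(1) aP i1 i2 by blast
  have cb: "col b \<noteq> col z" using theta_col[OF th] .
  have ev: "even (length P1)" "even (length (b # rev P2))" "even (length S)"
    using cb apath_parity P'(1) aP S(1) by blast+
  have evP: "even (length P)" using apath_parity[OF P(1)] proper[OF P(2)] by auto
  have l2: "length P1 \<ge> 2" "length S \<ge> 2" "length (b # rev P2) \<ge> 2"
    using apath_length2 P'(1) aP S(1,3) by blast+
  have sum: "length P1 + length (b # rev P2) = length P + 2"
    using P'(2,5) unfolding apath_def by (cases P2) auto
  \<comment> \<open>All lengths are even and the two arcs have \<open>length P + 2\<close> vertices
    together, at least six, so they are not both single edges.\<close>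
  have "length P1 \<ge> 4 \<or> length (b # rev P2) \<ge> 4" using sum evP ev P(3) l2 by presburger
  moreover have "length P1 \<ge> 4 \<and> length (b # rev P2) \<ge> 4" if "z \<noteq> a" "z \<noteq> P ! 1"
  proof -
    have "length P2 \<ge> 2" using apath_length2[OF P'(2)] that by blast
    then have "length (b # rev P2) \<ge> 4" using ev(2) by simp presburger
    moreover have "length P1 \<noteq> 2"
    proof
      assume "length P1 = 2"
      then have "P1 = [b, z]" using P'(1) unfolding apath_def
        by (cases P1 rule: remdups_adj.cases) auto
      then show False using that(2) P'(5) by simp
    qed
    then have "length P1 \<ge> 4" using l2(1) ev(1) by presburger
    ultimately show ?thesis by blast
  qed
  moreover have "length S \<ge> 4" if "length S \<ge> 3" using that ev(3) by presburger
  ultimately consider "length P1 \<ge> 4" "length (b # rev P2) \<ge> 4" | "length P1 \<ge> 4" "length S \<ge> 4"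
     | "length (b # rev P2) \<ge> 4" "length S \<ge> 4" using ne by blast
  then show False
    using theta_short[OF th] theta_short[OF theta_perm(2)[OF th]]
      theta_short[OF theta_perm(2)[OF theta_perm(1)[OF th]]] by cases blast+
qed

text \<open>A path avoiding both cycle neighbours of \<open>b\<close> would start with an ear from
  \<open>b\<close> to another vertex of the cycle.\<close>

lemma cycle_separated:
  assumes P: "apath b P a" "E a b" "length P \<ge> 3"
    and "d \<in> set P" "d \<noteq> b"
  shows "separated {a, P ! 1} b d"
  unfolding separated_def
proof (intro allI impI notI)
  fix Q assume Q: "apath b Q d" "set Q \<inter> {a, P ! 1} = {}"
  obtain S z where S: "apath b S z" "set S \<inter> (set P - {b}) = {z}" "set S \<subseteq> set Q"
    using apath_first_hit[OF Q(1), of "set P - {b}"] assms(4,5) by blast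
  have "b \<in> set S" "b \<in> set P" using S(1) P(1) apath_ends by blast+
  then have "set S \<inter> set P = {b, z}" "z \<noteq> b" "z \<noteq> a" "z \<noteq> P ! 1" using S(2,3) Q(2) by blast+
  then show False using no_ear[OF P S(1)] by blast
qed

text \<open>Rotating the cycle to start at \<open>q\<close> or at \<open>r\<close> makes both
  separations instances of \<open>cycle_separated\<close>, so the four vertices are
  cross-separated.\<close>

lemma four_consecutive_hit:
  assumes "cyc (p # q # r # s # R)" shows "{p, q, r, s} \<inter> W \<noteq> {}"
proof (rule no_cross_separated)
  have c1: "cyc (q # r # s # R @ [p])" using cyc_rotate[of "[p]" "q # r # s # R"] assms by simp
  have c2: "cyc (r # s # R @ [p, q])" using cyc_rotate[of "[q]" "r # s # R @ [p]"] c1 by simp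
  have a1: "apath q (q # r # s # R @ [p]) p" and a2: "apath r (r # s # R @ [p, q]) q"
    using c1 c2 by (auto simp: cyc_def apath_def)
  have es: "E p q" "E q r" "E r s" and dist: "distinct (p # q # r # s # R)"
    using assms by (auto simp: cyc_def)
  have "separated {p, r} q s" using cycle_separated[OF a1 es(1), of s] dist by auto
  moreover have "separated {q, s} r p" using cycle_separated[OF a2 es(2), of p] dist by auto
  then have "separated {q, s} p r" by (rule separated_sym)
  moreover have "col p = col r" using proper[OF es(1)] proper[OF es(2)] by blast
  ultimately show "cross_separated p q r s" using es dist unfolding cross_separated_def by auto
qed

lemma cyc_hd:
  assumes "cyc P" "x \<in> set P"
  obtains R where "cyc (x # R)" "set (x # R) = set P"
proof -
  obtain xs ys where P: "P = xs @ x # ys" using assms(2) by (auto simp: in_set_conv_decomp)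
  then show thesis using that[of "ys @ xs"] cyc_rotate[of xs "x # ys"] assms(1) by auto
qed

lemma cyc_hd_nbrs:
  assumes "cyc (x # R)"
  obtains s L where "R = s # L" "L \<noteq> []" "E x s" "E (last L) x" "s \<noteq> last L"
proof -
  obtain s L where R: "R = s # L" "L \<noteq> []" using assms unfolding cyc_def
    by (cases R; cases "tl R") auto
  then have "s \<noteq> last L" using assms last_in_set[of L] unfolding cyc_def by auto
  then show thesis using that[of s L] R assms unfolding cyc_def by auto
qed

text \<open>The cycle meets \<open>W\<close>, and hence contains \<open>w\<close>, since a cycle
  through \<open>v \<in> W\<close> uses both neighbours of \<open>v\<close>, one of which is
  \<open>w\<close>. It therefore reads \<open>w\<close>, \<open>t\<close>, \<open>M\<close>,
  \<open>v\<close>. If \<open>M\<close> had three vertices, they and \<open>t\<close> would give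
  four consecutive vertices avoiding \<open>W\<close>; as \<open>length M\<close> is odd, a single
  \<open>m\<close> remains.\<close>

lemma cycle_shape:
  assumes "cyc P"
  obtains m where "W \<noteq> {}" "E t m" "E m v" "distinct [v, w, t, m]" "set P = {v, w, t, m}"
proof -
  have "length P \<ge> 3" using assms unfolding cyc_def by blast
  then have l4: "length P \<ge> 4" using cyc_even[OF assms] by presburger
  have "set P \<inter> W \<noteq> {}"
  proof -
    obtain p q r s R where "P = p # q # r # s # R" using l4
      by (auto simp: numeral_eq_Suc Suc_le_length_iff)
    then show ?thesis using four_consecutive_hit[of p q r s R] assms by auto
  qed
  then have ne: "W \<noteq> {}" by auto
  have wP: "w \<in> set P"
  proof (rule ccontr)
    assume n: "w \<notin> set P"
    then have vP: "v \<in> W" "v \<in> set P" using \<open>set P \<inter> W \<noteq> {}\<close> W(2) by auto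
    obtain R where R: "cyc (v # R)" "set (v # R) = set P" using cyc_hd[OF assms vP(2)] .
    obtain s L where L: "R = s # L" "L \<noteq> []" "E v s" "E (last L) v" "s \<noteq> last L"
      using cyc_hd_nbrs[OF R(1)] .
    have "s = w \<or> last L = w" using v_nbr_w[OF vP(1) L(3) sym[OF L(4)] L(5)] .
    then have "w \<in> set R" using L(1,2) by auto
    then show False using n R(2) by auto
  qed
  obtain R where R: "cyc (w # R)" "set (w # R) = set P" using cyc_hd[OF assms wP] .
  obtain s L where L: "R = s # L" "L \<noteq> []" "E w s" "E (last L) w" "s \<noteq> last L"
    using cyc_hd_nbrs[OF R(1)] .
  have sl: "(s = t \<and> last L = v) \<or> (s = v \<and> last L = t)"
    using w_nbrs(2)[OF ne, of s] w_nbrs(2)[OF ne, of "last L"] L(3,5) sym[OF L(4)] by auto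
  obtain M where M: "cyc (w # t # M @ [v])" "set (w # t # M @ [v]) = set P"
  proof (cases "s = t")
    case True
    then have "L = butlast L @ [v]" using sl L(2,5) by (metis append_butlast_last_id)
    then show thesis using that[of "butlast L"] R L(1) True by metis
  next
    case False
    then have "L = butlast L @ [t]" "s = v" using sl L(2) by (metis append_butlast_last_id)+
    then have 1: "w # R = w # v # butlast L @ [t]" using L(1) by simp
    have "cyc (rev (v # butlast L @ [t]) @ [w])" using cyc_rev[OF R(1)] unfolding 1 by simp
    then have "cyc ([w] @ rev (v # butlast L @ [t]))" by (rule cyc_rotate)
    then have "cyc (w # t # rev (butlast L) @ [v])" by simp
    moreover have "set (w # t # rev (butlast L) @ [v]) = set P" using R(2) unfolding 1 by auto
    ultimately show thesis using that by blast
  qed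
  have oddM: "odd (length M)" using cyc_even[OF M(1)] by simp
  have "length M < 3"
  proof (rule ccontr)
    assume "\<not> ?thesis"
    then obtain x y z R' where M': "M = x # y # z # R'"
      by (auto simp: not_less numeral_eq_Suc Suc_le_length_iff)
    have "cyc (t # x # y # z # R' @ [v, w])" using cyc_rotate[of "[w]" "t # M @ [v]"] M(1) M'
      by simp
    then have "{t, x, y, z} \<inter> W \<noteq> {}" by (rule four_consecutive_hit)
    moreover have "{t, x, y, z} \<inter> {w, v} = {}" using M(1) M' unfolding cyc_def by auto
    ultimately show False using W(2) by blast
  qed
  then have "length M = 1" using oddM by presburger
  then obtain m where m: "M = [m]" by (auto simp: length_Suc_conv)
  then have "E t m" "E m v" "distinct [v, w, t, m]" "set P = {v, w, t, m}"
    using M unfolding cyc_def by auto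
  then show thesis using that ne by blast
qed

section \<open>The exceptional 4-cycle\<close>

lemma square_no_ear:
  assumes C: "E w v" "E w t" "E t m" "E m v" "distinct [v, w, t, m]"
    and x: "x \<in> {v, w, t, m}" and S: "apath x S z" "z \<noteq> x" "length S \<ge> 3"
  shows "set S \<inter> {v, w, t, m} \<noteq> {x, z}"
proof
  assume i: "set S \<inter> {v, w, t, m} = {x, z}"
  have p: "apath v [v, w, t, m] m" "apath w [w, t, m, v] v" "apath t [t, m, v, w] w"
    "apath m [m, v, w, t] t"
    using C sym unfolding apath_def by auto
  have s: "{v, w, t, m} = set [v, w, t, m]" "{v, w, t, m} = set [w, t, m, v]"
      "{v, w, t, m} = set [t, m, v, w]" "{v, w, t, m} = set [m, v, w, t]" by auto
  note i' = i[unfolded s(1)] i[unfolded s(2)] i[unfolded s(3)] i[unfolded s(4)]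
  show False
    using x no_ear[OF p(1), of S z] no_ear[OF p(2), of S z] no_ear[OF p(3), of S z] no_ear[OF p(4), of S z]
      i' C(1-4) sym S by auto
qed

text \<open>From an edge missing the square, a path reaches the square at some \<open>k\<close>,
  since otherwise that edge and \<open>tm\<close> would be cross-separated. If \<open>q1\<close>,
  \<open>q2\<close> are the last two vertices before \<open>k\<close>, then \<open>q1 q2\<close> and
  a square edge at \<open>k\<close> are cross-separated and avoid \<open>W\<close>.\<close>

lemma square_edge:
  assumes ne: "W \<noteq> {}" and C: "E t m" "E m v" "distinct [v, w, t, m]" and yz: "E y z"
  shows "{y, z} \<inter> {v, w, t, m} \<noteq> {}"
proof
  let ?C = "{v, w, t, m}"
  assume yzC: "{y, z} \<inter> ?C = {}"
  have wE: "E w v" "E w t" using w_nbrs(2)[OF ne] by auto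
  note no_ear' = square_no_ear[OF wE C]
  obtain y z where yz: "E y z" "col y = col t" "y \<notin> ?C" "z \<notin> ?C"
  proof (cases "col y = col t")
    case True
    then show thesis using that yz yzC by blast
  next
    case False
    then have "col z = col t" using proper[OF yz] by blast
    then show thesis using that[of z y] sym[OF yz] yzC by blast
  qed
  have "{y, z, t, m} \<inter> W = {}" using yz W(2) C(3) by auto
  then have "\<not> cross_separated y z t m" using no_cross_separated by blast
  then have "\<not> separated {y, t} z m \<or> \<not> separated {z, m} y t"
    using yz C unfolding cross_separated_def by blast
  \<comment> \<open>Whichever separation fails, an end \<open>x'\<close> of the edge is joined to
    the square by a path avoiding the other end \<open>o'\<close>. Prepending \<open>o'\<close> will
    guarantee two vertices outside the square before \<open>k\<close>.\<close>
  then obtain x' o' Q q where Q: "E o' x'" "apath x' Q q" "o' \<notin> set Q" "q \<in> ?C" "o' \<notin> ?C" "x' \<notin> ?C"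
    unfolding separated_def using yz sym by blast
  obtain S k where S: "apath x' S k" "set S \<inter> ?C = {k}" "set S \<subseteq> set Q"
    using apath_first_hit[OF Q(2,4)] by blast
  have kC: "k \<in> ?C" using S(2) by blast
  have oS: "o' \<notin> set S" using S(3) Q(3) by blast
  have aS: "apath o' (o' # S) k" using apath_Cons[OF S(1) Q(1) oS] .
  have "length S \<ge> 2" using apath_length2[OF S(1)] kC Q(6) by blast
  then have "length (o' # S) \<ge> 3" by simp
  then obtain L q1 q2 where L: "o' # S = L @ [q1, q2, k]" "E q1 q2" "E q2 k" "q1 \<noteq> k"
    using apath_snoc_obtain[OF aS] by metis
  have qC: "q1 \<notin> ?C" "q2 \<notin> ?C"
  proof -
    have d: "distinct (o' # S)" using aS unfolding apath_def by blast
    have "set (o' # S) \<inter> ?C = {k}" using S(2) Q(5) by auto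
    moreover have "q1 \<in> set (o' # S)" "q2 \<in> set (o' # S)" unfolding L(1) by auto
    moreover have "q2 \<noteq> k" using d unfolding L(1) by auto
    ultimately show "q1 \<notin> ?C" "q2 \<notin> ?C" using L(4) by blast+
  qed
  have kw: "k \<noteq> w" using w_nbrs(2)[OF ne] sym[OF L(3)] qC(2) by blast
  have kW: "k \<notin> W"
  proof
    assume "k \<in> W"
    then have "k = v" "v \<in> W" using W(2) kw by auto
    then show False using v_nbr_w[of q2 m] sym[OF L(3)] sym[OF C(2)] qC C(3) by auto
  qed
  \<comment> \<open>Every square vertex other than \<open>w\<close> has a neighbour in
    \<open>{t, m}\<close>, which is disjoint from \<open>W\<close>.\<close>
  have "\<exists>k'\<in>{t, m}. E k k'" using kC kw C sym by auto
  then obtain k' where k': "k' \<in> {t, m}" "E k k'" by blast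
  have "cross_separated q1 q2 k k'"
    unfolding cross_separated_def
  proof (intro conjI)
    show "q2 \<noteq> k'" using k' qC by blast
    show "col q1 = col k" using proper[OF L(2)] proper[OF L(3)] by blast
    show "separated {q1, k} q2 k'" unfolding separated_def
    proof (intro allI impI notI)
      fix Q assume Q: "apath q2 Q k'" "set Q \<inter> {q1, k} = {}"
      obtain S z where S: "apath q2 S z" "set S \<inter> ?C = {z}" "set S \<subseteq> set Q"
        using apath_first_hit[OF Q(1), of ?C] k'(1) by blast
      have kS: "k \<notin> set S" using S(3) Q(2) by blast
      have "z \<in> set S" "q2 \<noteq> z" "z \<noteq> k" using S(2) qC kS by blast+
      then have "length (k # S) \<ge> 3" using apath_length2[OF S(1)] by simp
      moreover have "set (k # S) \<inter> ?C = {k, z}" using S(2) kC by auto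
      ultimately show False using no_ear'[OF kC apath_Cons[OF S(1) sym[OF L(3)] kS] \<open>z \<noteq> k\<close>]
        by blast
    qed
    show "separated {q2, k'} q1 k" unfolding separated_def
    proof (intro allI impI notI)
      fix Q assume Q: "apath q1 Q k" "set Q \<inter> {q2, k'} = {}"
      obtain S z where S: "apath q1 S z" "set S \<inter> ?C = {z}" "set S \<subseteq> set Q"
        using apath_first_hit[OF Q(1), of ?C] kC by blast
      have q2S: "q2 \<notin> set S" using S(3) Q(2) by blast
      have zS: "z \<in> set S" "q1 \<noteq> z" using S(2) qC by blast+
      have l: "length S \<ge> 2" using apath_length2[OF S(1) zS(2)] .
      have aS: "apath q2 (q2 # S) z" using apath_Cons[OF S(1) sym[OF L(2)] q2S] .
      show False
      proof (cases "z = k")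
        case True
        \<comment> \<open>Returning to the square at \<open>k\<close> itself closes a cycle that
          misses \<open>w\<close>, contrary to \<open>cycle_shape\<close>.\<close>
        then have "cyc (q2 # S)" using aS l sym[OF L(3)] unfolding cyc_def apath_def by simp
        then obtain m' where "E t m'" "E m' v" "distinct [v, w, t, m']"
          "set (q2 # S) = {v, w, t, m'}"
          by (rule cycle_shape)
        moreover have "w \<notin> set (q2 # S)" using Int_singletonD[OF S(2), of w] True kw qC(2) by auto
        ultimately show False by blast
      next
        case False
        then have kS: "k \<notin> set (q2 # S)" using Int_singletonD[OF S(2), of k] kC qC by auto
        have "set (k # q2 # S) \<inter> ?C = {k, z}" using S(2) kC qC by auto
        moreover have "length (k # q2 # S) \<ge> 3" using l by simp
        ultimately show False using no_ear'[OF kC apath_Cons[OF aS sym[OF L(3)] kS] False] by blast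
      qed
    qed
  qed (use L k' in auto)
  moreover have "{q1, q2, k, k'} \<inter> W = {}" using qC kW k'(1) W(2) C(3) by auto
  ultimately show False using no_cross_separated by blast
qed

text \<open>A cycle would be the square. Both given edges avoid \<open>w\<close> and
  \<open>v\<close> but meet the square, so, being disjoint, one leaves it at \<open>t\<close> and
  the other at \<open>m\<close>. With outer ends \<open>x\<close> and \<open>y\<close>, the edges
  \<open>xt\<close> and \<open>my\<close> are cross-separated because the square has no
  ears.\<close>

lemma no_cycle: "\<not> cyc P"
proof
  assume "cyc P"
  then obtain m where ne: "W \<noteq> {}" and C: "E t m" "E m v" "distinct [v, w, t, m]"
    by (rule cycle_shape)
  let ?C = "{v, w, t, m}"
  have wE: "E w v" "E w t" using w_nbrs(2)[OF ne] by auto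
  note no_ear' = square_no_ear[OF wE C]
  have av: "{e1, e2, f1, f2} \<inter> {w, v} = {}" using ef_avoid ne by blast
  have "{e1, e2} \<inter> {t, m} \<noteq> {}" "{f1, f2} \<inter> {t, m} \<noteq> {}"
    using square_edge[OF ne C e] square_edge[OF ne C f] av by blast+
  then obtain g g' h h' where gh: "g \<in> {t, m}" "{g, g'} = {e1, e2}" "h \<in> {t, m}"
    "{h, h'} = {f1, f2}"
    by blast
  have E': "E g g'" "E h h'" using gh(2,4) e f sym unfolding doubleton_eq_iff by blast+
  have "g \<in> {e1, e2}" "g' \<in> {e1, e2}" "h \<in> {f1, f2}" "h' \<in> {f1, f2}" using gh(2,4) by blast+
  then have "g \<noteq> h" "g' \<noteq> h" "h' \<noteq> g" using ef by auto
  moreover have "{g', h'} \<inter> {w, v} = {}" using gh(2,4) av by blast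
  moreover have "g' \<noteq> g" "h' \<noteq> h" using E' edge_neq by blast+
  ultimately obtain x y where xy: "E t x" "E m y" "x \<notin> ?C" "y \<notin> ?C"
    using E' gh(1,3) that by blast
  \<comment> \<open>A path from \<open>x'\<close> back to the square that avoids \<open>k\<close>
    would, preceded by \<open>k\<close>, contain an ear.\<close>
  have sep: "separated (insert k X) x' k'"
    if k: "k \<in> ?C" "k' \<in> ?C" "k' \<noteq> k" "E k x'" "x' \<notin> ?C" for k k' x' X
    unfolding separated_def
  proof (intro allI impI notI)
    fix Q assume Q: "apath x' Q k'" "set Q \<inter> insert k X = {}"
    obtain S z where S: "apath x' S z" "set S \<inter> ?C = {z}" "set S \<subseteq> set Q"
      using apath_first_hit[OF Q(1) k(2)] by blast
    have kS: "k \<notin> set S" using S(3) Q(2) by blast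
    have "z \<in> set S" "x' \<noteq> z" "z \<noteq> k" using S(2) k(5) kS by blast+
    then have "length (k # S) \<ge> 3" using apath_length2[OF S(1)] by simp
    moreover have "set (k # S) \<inter> ?C = {k, z}" using S(2) k(1) by auto
    ultimately show False using no_ear'[OF k(1) apath_Cons[OF S(1) k(4) kS] \<open>z \<noteq> k\<close>] by blast
  qed
  have "cross_separated x t m y"
    unfolding cross_separated_def
  proof (intro conjI)
    show "col x = col m" using proper[OF xy(1)] proper[OF C(1)] by blast
    have "separated {m, x} y t" using sep[of m t y "{x}"] xy C(3) by auto
    then show "separated {x, m} t y" using separated_sym by (metis insert_commute)
    show "separated {t, y} x m" using sep[of t m x "{y}"] xy C(3) by auto
  qed (use xy sym in auto)
  moreover have "{x, t, m, y} \<inter> W = {}" using xy W(2) C(3) by auto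
  ultimately show False using no_cross_separated by blast
qed

section \<open>The remaining case of a forest\<close>

text \<open>Around \<open>w\<close> the path reads \<open>x\<close>, \<open>y\<close>,
  \<open>v\<close>, \<open>w\<close>, \<open>t\<close>, \<open>r\<close>. These are five edges, an
  odd number, so the two end edges are cross-separated in the forest, and they avoid
  \<open>w\<close> and \<open>v\<close>.\<close>

lemma forest_path_through_W:
  assumes P: "apath p P q" "P = L @ [v, w, t] @ R" "length L \<ge> 2" "R \<noteq> []"
    and "W \<noteq> {}"
  shows False
proof -
  obtain x y L' where L: "L = L' @ [x, y]"
  proof -
    have "length (rev L) \<ge> 2" using P(3) by simp
    then obtain y x L' where "rev L = y # x # L'"
      by (auto simp: numeral_eq_Suc Suc_le_length_iff simp del: length_rev)
    then have "L = rev L' @ [x, y]"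
      by (metis append.assoc append_Cons append_Nil rev.simps(2) rev_rev_ident)
    then show thesis using that by blast
  qed
  obtain r R' where R: "R = r # R'" using P(4) by (cases R) auto
  have ap: "apath x (x # [y, v, w, t] @ [r]) r"
    using P(1,2) L R by (auto simp: apath_def successively_append_iff)
  then have "col x \<noteq> col y" "col y \<noteq> col v" "col v \<noteq> col w" "col w \<noteq> col t"
    using proper by (auto simp: apath_def)
  then have "col x = col (last [y, v, w, t])" by auto
  then have "cross_separated x y t r" using forest_cross_separated[OF no_cycle ap] by simp
  moreover have "{x, y, t, r} \<inter> W = {}" using ap W(2) unfolding apath_def by auto
  ultimately show False using no_cross_separated by blast
qed

text \<open>Some path joins the two given edges, for otherwise they would be cross-separated
  themselves. If it avoids \<open>W\<close>, its first four vertices suffice; otherwise it runs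
  through \<open>v\<close>, \<open>w\<close>, \<open>t\<close>.\<close>

lemma contradiction: False
proof -
  obtain x y x' y' Q where Q: "apath y Q y'" "E x y" "E y' x'" "x \<notin> set Q" "x' \<notin> set Q" "x \<noteq> x'"
    "y \<noteq> y'"
     and xy: "{x, y, x', y'} = {e1, e2, f1, f2}"
  proof -
    note found = that
    \<comment> \<open>The ends of the second edge are named so that \<open>e1\<close> and
      \<open>c'\<close> have the same colour.\<close>
    have main: thesis if f: "E c' d'" and cd: "{c', d'} = {f1, f2}" "col e1 = col c'" for c' d'
    proof -
      have n: "e1 \<noteq> c'" "e2 \<noteq> d'" "e1 \<noteq> d'" "e2 \<noteq> c'" and "\<not> cross_separated e1 e2 c' d'"
        using ef cd no_cross_separated[of e1 e2 c' d'] ef_avoid W(2) by blast+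
      then have "\<not> separated {e1, c'} e2 d' \<or> \<not> separated {e2, d'} e1 c'"
        using e f cd unfolding cross_separated_def by blast
      then show thesis
      proof
        assume "\<not> separated {e1, c'} e2 d'"
        then obtain Q where "apath e2 Q d'" "e1 \<notin> set Q" "c' \<notin> set Q" unfolding separated_def
          by blast
        then show thesis using found[of e2 Q d' e1 c'] e sym[OF f] n cd(1) by blast
      next
        assume "\<not> separated {e2, d'} e1 c'"
        then obtain Q where "apath e1 Q c'" "e2 \<notin> set Q" "d' \<notin> set Q" unfolding separated_def
          by blast
        then show thesis using found[of e1 Q c' e2 d'] sym[OF e] f n cd(1) by blast
      qed
    qed
    show thesis
    proof (cases "col e1 = col f1")
      case True
      then show thesis using main[of f1 f2] f by blast
    next
      case False
      then have "col e1 = col f2" using proper[OF f] by blast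
      then show thesis using main[of f2 f1] sym[OF f] by blast
    qed
  qed
  let ?P = "x # Q @ [x']"
  have aP: "apath x ?P x'"
    using apath_Cons[OF apath_snoc[OF Q(1,3,5)] Q(2)] Q(4,6) by simp
  have lQ: "length Q \<ge> 2" using apath_length2[OF Q(1,7)] .
  \<comment> \<open>\<open>Z\<close> is the path in the direction in which \<open>v\<close> precedes
    \<open>w\<close>. Its first two and last two vertices are ends of the given edges and avoid
    \<open>w\<close> and \<open>v\<close>, which forces two vertices before \<open>v\<close> and one
    after \<open>t\<close>.\<close>
  have through: False if "W \<noteq> {}" "Z = ?P \<or> Z = rev ?P" "Z = L @ [v, w, t] @ R" for Z L R
  proof -
    note hyp = that
    have av: "{x, y, x', y'} \<inter> {w, v} = {}" using ef_avoid[OF hyp(1)] xy by simp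
    obtain x0 y0 M y1 x1 where Z: "Z = x0 # y0 # M" "rev Z = x1 # y1 # rev (butlast (butlast Z))"
       "{x0, y0, x1, y1} \<inter> {w, v} = {}" and aZ: "apath x0 Z x1"
    proof -
      obtain Q1 where Q1: "Q = y # Q1" using Q(1) unfolding apath_def by (cases Q) auto
      obtain Q2 where Q2: "Q = Q2 @ [y']" using Q(1) unfolding apath_def
        by (metis append_butlast_last_id)
      have 1: "?P = x # y # Q1 @ [x']" using Q1 by simp
      have 2: "?P = (x # Q2) @ [y', x']" using Q2 by simp
      show thesis using hyp(2)
      proof
        assume Z: "Z = ?P"
        show thesis
        proof (rule that[of x y "Q1 @ [x']" x' y'])
          show "Z = x # y # Q1 @ [x']" using Z 1 by simp
          show "rev Z = x' # y' # rev (butlast (butlast Z))" using Z 2 by (simp add: butlast_append)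
        qed (use av aP Z in auto)
      next
        assume Z: "Z = rev ?P"
        show thesis
        proof (rule that[of x' y' "rev (x # Q2)" x y])
          show "Z = x' # y' # rev (x # Q2)" using Z 2 by simp
          have "rev Z = x # y # Q1 @ [x']" using Z 1 by simp
          moreover have "Z = rev (Q1 @ [x']) @ [y, x]" using Z 1 by simp
          ultimately show "rev Z = x # y # rev (butlast (butlast Z))" by (simp add: butlast_append)
        qed (use av apath_rev[OF aP] Z in auto)
      qed
    qed
    have "length L \<ge> 2" using Z(1,3) hyp(3) by (cases L rule: remdups_adj.cases) auto
    moreover have "R \<noteq> []"
    proof
      assume "R = []"
      then have "rev Z = t # w # v # rev L" using hyp(3) by simp
      then show False using Z(2,3) by auto
    qed
    ultimately show False using forest_path_through_W[OF aZ hyp(3) _ _ hyp(1)] by blast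
  qed
  show False
  proof (cases "set ?P \<inter> W = {}")
    case True
    obtain q1 q2 Q' where Q': "Q = q1 # q2 # Q'" using lQ
      by (auto simp: numeral_eq_Suc Suc_le_length_iff)
    obtain q3 Q'' where "Q' @ [x'] = q3 # Q''" by (cases "Q' @ [x']") auto
    then have P: "?P = x # q1 # q2 # q3 # Q''" using Q' by simp
    then have ap: "apath x (x # [q1, q2] @ [q3]) q3" using aP by (auto simp: apath_def)
    then have "col x = col (last [q1, q2])" using proper by (auto simp: apath_def)
    then have "cross_separated x q1 q2 q3" using forest_cross_separated[OF no_cycle ap] by simp
    moreover have "{x, q1, q2, q3} \<inter> W = {}" using True unfolding P by auto
    ultimately show False using no_cross_separated by blast
  next
    case False
    then have ne: "W \<noteq> {}" by blast
    have av: "{x, x'} \<inter> {w, v} = {}" using ef_avoid[OF ne] xy by auto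
    have wP: "w \<in> set ?P"
    proof (rule ccontr)
      assume n: "w \<notin> set ?P"
      then have v: "v \<in> W" "v \<in> set ?P" "v \<noteq> x" "v \<noteq> x'" using False W(2) av by auto
      obtain L s r R where "?P = L @ [s, v, r] @ R" "E s v" "E v r" "s \<noteq> r"
        using apath_interior_nbrs[OF aP v(2-4)] .
      then show False using v_nbr_w[OF v(1), of s r] sym n by auto
    qed
    obtain L s r R where sr: "?P = L @ [s, w, r] @ R" "E s w" "E w r" "s \<noteq> r"
      using apath_interior_nbrs[OF aP wP] av by blast
    have "(s = v \<and> r = t) \<or> (s = t \<and> r = v)"
      using w_nbrs(2)[OF ne, of s] w_nbrs(2)[OF ne, of r] sym[OF sr(2)] sr(3,4) by auto
    then show False
    proof
      assume "s = v \<and> r = t"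
      then show False using through[OF ne, of ?P L R] sr(1) by blast
    next
      assume "s = t \<and> r = v"
      then have "rev ?P = rev R @ [v, w, t] @ rev L" using sr(1) by simp
      then show False using through[OF ne, of "rev ?P"] by blast
    qed
  qed
qed

end

context even_theta_free begin

text \<open>The locale \<open>counterexample\<close> consists of these hypotheses and the negated
  conclusion, and it is inconsistent.\<close>

lemma cross_separated_avoiding:
  assumes "W \<noteq> {} \<Longrightarrow> w \<in> W" "W \<subseteq> {w, v}"
    and "W \<noteq> {} \<Longrightarrow> v \<noteq> t" "\<And>y. W \<noteq> {} \<Longrightarrow> E w y \<longleftrightarrow> y = v \<or> y = t"
    and "v \<in> W \<Longrightarrow> \<exists>t'. \<forall>y. E v y \<longleftrightarrow> y = w \<or> y = t'"
    and "E e1 e2" "E f1 f2" "{e1, e2} \<inter> {f1, f2} = {}"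
    and "W \<noteq> {} \<Longrightarrow> {e1, e2, f1, f2} \<inter> {w, v} = {}"
  shows "\<exists>p q r s. cross_separated p q r s \<and> {p, q, r, s} \<inter> W = {}"
proof (rule ccontr)
  assume n: "\<not> ?thesis"
  interpret counterexample E col W w v t e1 e2 f1 f2
  proof
    show "{p, q, r, s} \<inter> W \<noteq> {}" if "cross_separated p q r s" for p q r s
      using n that by blast
  qed (erule assms | rule assms)+
  show False by (rule contradiction)
qed

end

subsection \<open>Root graphs of line trigraphs\<close>

text \<open>The Boolean tag makes the two sides of the root graph disjoint and serves as the colouring.\<close>

definition ends :: "('a \<Rightarrow> nat \<times> nat) \<Rightarrow> 'a \<Rightarrow> (bool \<times> nat) set" where
  "ends f e = {(False, fst (f e)), (True, snd (f e))}"

definition root_edge :: "'a trigraph \<Rightarrow> ('a \<Rightarrow> nat \<times> nat) \<Rightarrow> bool \<times> nat \<Rightarrow> bool \<times> nat \<Rightarrow> bool" where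
  "root_edge T f x y \<longleftrightarrow> (\<exists>e\<in>verts T. ends f e = {x, y})"

locale line_trigraph_rep =
  fixes T :: "'a trigraph" and f :: "'a \<Rightarrow> nat \<times> nat"
  assumes trigraph: "is_trigraph T" and inj: "inj_on f (verts T)"
    and adj_f: "u \<in> verts T \<Longrightarrow> v \<in> verts T \<Longrightarrow> u \<noteq> v \<Longrightarrow>
      adj T u v \<longleftrightarrow> fst (f u) = fst (f v) \<or> snd (f u) = snd (f v)"
    and strong: "is_clique T K \<Longrightarrow> card K \<ge> 3 \<Longrightarrow> is_strong_clique T K"
begin

sublocale bipartite_graph "root_edge T f" fst
proof
  fix x y assume "root_edge T f x y"
  then show "root_edge T f y x" "fst x \<noteq> fst y"
    by (auto simp: root_edge_def ends_def insert_commute doubleton_eq_iff)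
qed

lemma adj_iff: "u \<in> verts T \<Longrightarrow> v \<in> verts T \<Longrightarrow> u \<noteq> v \<Longrightarrow> adj T u v \<longleftrightarrow> ends f u \<inter> ends f v \<noteq> {}"
  using adj_f by (auto simp: ends_def)

lemma ends_inj: "u \<in> verts T \<Longrightarrow> v \<in> verts T \<Longrightarrow> ends f u = ends f v \<Longrightarrow> u = v"
  using inj by (auto simp: ends_def doubleton_eq_iff inj_on_def prod_eq_iff)

lemma ends_col: "ends f u = {x, y} \<Longrightarrow> fst x \<noteq> fst y"
  by (auto simp: ends_def doubleton_eq_iff)

lemma adj_sym: "adj T u v \<Longrightarrow> adj T v u"
  using trigraph unfolding is_trigraph_def adj_def by metis

lemma ends_other: "x \<in> ends f u \<Longrightarrow> \<exists>y. ends f u = {x, y}"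
  by (auto simp: ends_def)

lemma ends_eq_doubleton: "x \<in> ends f u \<Longrightarrow> y \<in> ends f u \<Longrightarrow> x \<noteq> y \<Longrightarrow> ends f u = {x, y}"
  by (auto simp: ends_def)

text \<open>A triangle is a clique with three vertices, hence strong. Consequently a switchable pair
  lies in no triangle.\<close>

lemma strong_triangle:
  assumes "adj T x y" "adj T x z" "adj T y z"
  shows "strongly_adj T x y \<and> strongly_adj T x z \<and> strongly_adj T y z"
proof -
  have d: "x \<noteq> y" "x \<noteq> z" "y \<noteq> z" "x \<in> verts T" "y \<in> verts T" "z \<in> verts T" using assms
    unfolding adj_def by auto
  then have "is_clique T {x, y, z}" using assms adj_sym unfolding is_clique_def by auto
  moreover have "card {x, y, z} \<ge> 3" using d by simp
  ultimately have "is_strong_clique T {x, y, z}" by (rule strong)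
  then show ?thesis using d unfolding is_strong_clique_def by auto
qed

lemma not_strong_antiadj: "strongly_adj T x y \<Longrightarrow> \<not> antiadj T x y"
  "strongly_adj T x y \<Longrightarrow> \<not> semiadj T x y"
  by (auto simp: strongly_adj_def antiadj_def semiadj_def)

lemma strongly_antiadj_iff:
  "strongly_antiadj T u v \<longleftrightarrow> u \<in> verts T \<and> v \<in> verts T \<and> u \<noteq> v \<and> \<not> adj T u v"
  using trigraph unfolding is_trigraph_def strongly_antiadj_def adj_def by auto

text \<open>A chord \<open>xy\<close> is a switchable pair, so the root vertex shared by \<open>x\<close> and \<open>y\<close> lies on no other
  edge. All path neighbours of \<open>x\<close> therefore meet \<open>x\<close> at its other end and are pairwise adjacent.\<close>

lemma path_chord_at_end:
  assumes p: "is_path T p" and ij: "i < length p" "j < length p" "i + 1 < j \<or> j + 1 < i"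
    and "adj T (p ! i) (p ! j)"
  shows "i = 0 \<or> i = length p - 1"
proof (rule ccontr)
  assume "\<not> ?thesis"
  then have i: "0 < i" "i - 1 < length p" "i + 1 < length p" using ij by auto
  note P = p[unfolded is_path_def]
  let ?x = "p ! i" and ?y = "p ! j"
  have anti: "antiadj T ?x ?y" using P ij by blast
  obtain k where k: "k \<in> ends f ?x" "k \<in> ends f ?y"
    using adj_iff assms(5) unfolding adj_def by blast
  obtain u where u: "ends f ?x = {k, u}" using ends_other[OF k(1)] by blast
  have other: "u \<in> ends f (p ! i')" if i': "i' < length p" "i' \<noteq> j" "i' + 1 = i \<or> i + 1 = i'" for i'
  proof -
    let ?z = "p ! i'"
    have xz: "adj T ?x ?z" using P ij(1) i' by blast
    have "?y \<noteq> ?z" using P ij i' by (simp add: nth_eq_iff_index_eq)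
    moreover have "\<not> adj T ?y ?z"
      using strong_triangle[OF assms(5) xz] anti not_strong_antiadj(1) by blast
    ultimately have "k \<notin> ends f ?z" using k(2) adj_iff[of ?y ?z] xz assms(5) unfolding adj_def
      by blast
    moreover have "ends f ?x \<inter> ends f ?z \<noteq> {}" using adj_iff[of ?x ?z] xz unfolding adj_def by blast
    ultimately show ?thesis unfolding u by blast
  qed
  let ?l = "p ! (i - 1)" and ?r = "p ! (i + 1)"
  have "u \<in> ends f ?l" "u \<in> ends f ?r" using other[of "i - 1"] other[of "i + 1"] i ij(3) by auto
  moreover have lr: "?l \<in> verts T" "?r \<in> verts T" "?l \<noteq> ?r" using P i
    by (auto simp: nth_eq_iff_index_eq)
  ultimately have "adj T ?l ?r" using adj_iff by blast
  moreover have "i - 1 + 1 = i" using i by simp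
  then have "adj T ?l ?x" using P i ij by blast
  moreover have "adj T ?x ?r" using P i ij by blast
  ultimately have "strongly_adj T ?l ?r" using strong_triangle by blast
  moreover have "antiadj T ?l ?r" using P i by simp
  ultimately show False using not_strong_antiadj(1) by blast
qed

text \<open>Both vertices of a chord are ends of the path, so the chord would join
  \<open>hd p\<close> to \<open>last p\<close>.\<close>

lemma path_no_chord:
  assumes p: "is_path T p" and na: "\<not> adj T (hd p) (last p)" and ij: "i + 1 < j" "j < length p"
  shows "ends f (p ! i) \<inter> ends f (p ! j) = {}"
proof (rule ccontr)
  assume n: "\<not> ?thesis"
  note P = p[unfolded is_path_def]
  have "p ! i \<noteq> p ! j" "p ! i \<in> verts T" "p ! j \<in> verts T" using P ij
    by (auto simp: nth_eq_iff_index_eq)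
  then have a: "adj T (p ! i) (p ! j)" using n adj_iff by blast
  have "i = 0 \<or> i = length p - 1" using path_chord_at_end[OF p _ _ _ a] ij by simp
  then have i: "i = 0" using ij by auto
  have "j = 0 \<or> j = length p - 1" using path_chord_at_end[OF p _ _ _ adj_sym[OF a]] ij by simp
  then have j: "j = length p - 1" using ij by auto
  show False using a na P unfolding i j by (simp add: hd_conv_nth last_conv_nth)
qed

text \<open>\<open>X\<close> lists the root vertices shared by consecutive members of
  \<open>p\<close>, so it has as many vertices as \<open>p\<close> has steps. The unshared ends of
  \<open>hd p\<close> and \<open>last p\<close> are left out, which gives the last two
  properties.\<close>

lemma path_to_root_path:
  assumes p: "is_path T p" and na: "\<not> adj T (hd p) (last p)" "hd p \<noteq> last p"
  obtains x X y where "apath x X y" "length X = path_len p" "x \<in> ends f (hd p)"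
    "y \<in> ends f (last p)"
    "\<And>z. z \<in> set X \<Longrightarrow> z \<in> ends f (hd p) \<Longrightarrow> z = x" "\<And>z. z \<in> set X \<Longrightarrow> z \<in> ends f (last p) \<Longrightarrow> z = y"
proof -
  note P = p[unfolded is_path_def]
  define n where "n = length p - 1"
  define xs where "xs i = (SOME x. x \<in> ends f (p ! i) \<inter> ends f (p ! Suc i))" for i
  have lp: "length p = Suc n" using P unfolding n_def by (cases p) auto
  have n2: "n \<ge> 1" using na(2) lp by (cases p; cases "tl p") auto
  have hl: "hd p = p ! 0" "last p = p ! n" using P lp by (auto simp: hd_conv_nth last_conv_nth)
  have xs: "xs i \<in> ends f (p ! i) \<inter> ends f (p ! Suc i)" if "i < n" for i
  proof -
    have "adj T (p ! i) (p ! Suc i)" using P that lp by simp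
    then have "\<exists>x. x \<in> ends f (p ! i) \<inter> ends f (p ! Suc i)" using adj_iff unfolding adj_def by blast
    then show ?thesis unfolding xs_def by (rule someI_ex)
  qed
  \<comment> \<open>A shared root vertex on a third member of \<open>p\<close> would give a
    chord.\<close>
  have xs_ends: "j = i \<or> j = Suc i" if "i < n" "j \<le> n" "xs i \<in> ends f (p ! j)" for i j
  proof (rule ccontr)
    assume "\<not> ?thesis"
    then consider "j + 1 < Suc i" | "i + 1 < j" by linarith
    then show False
      using path_no_chord[OF p na(1), of j
        "Suc i"] path_no_chord[OF p na(1), of i j] xs[OF that(1)] that lp
      by cases auto
  qed
  have inj: "i = j" if "i < n" "j < n" "xs i = xs j" for i j
  proof -
    have "xs i \<in> ends f (p ! j)" "xs i \<in> ends f (p ! Suc j)" using xs[OF that(2)] that(3) by auto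
    then have "j = i \<or> j = Suc i" "Suc j = i \<or> Suc j = Suc i"
      using xs_ends[OF that(1), of j] xs_ends[OF that(1), of "Suc j"] that by auto
    then show ?thesis by auto
  qed
  let ?X = "map xs [0..<n]"
  have "distinct ?X" using inj by (auto simp: distinct_map inj_on_def)
  moreover have "successively (root_edge T f) ?X"
    unfolding successively_conv_nth
  proof (intro allI impI)
    fix i assume "Suc i < length ?X"
    then have i: "Suc i < n" by simp
    have "xs i \<noteq> xs (Suc i)" using inj[of i "Suc i"] i by auto
    moreover have "xs i \<in> ends f (p ! Suc i)" "xs (Suc i) \<in> ends f (p ! Suc i)"
      using xs[of i] xs[of "Suc i"] i by auto
    ultimately have "ends f (p ! Suc i) = {xs i, xs (Suc i)}" using ends_eq_doubleton by blast
    moreover have "p ! Suc i \<in> verts T" using P i lp by auto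
    ultimately show "root_edge T f (?X ! i) (?X ! Suc i)" using i unfolding root_edge_def by auto
  qed
  ultimately have "apath (xs 0) ?X (xs (n - 1))"
    using n2 unfolding apath_def by (auto simp: hd_map last_map)
  moreover have "length ?X = path_len p" unfolding path_len_def n_def by simp
  moreover have "xs 0 \<in> ends f (hd p)" "xs (n - 1) \<in> ends f (last p)"
    using xs[of 0] xs[of "n - 1"] n2 unfolding hl by auto
  moreover have "z = xs 0" if zX: "z \<in> set ?X" and ze: "z \<in> ends f (hd p)" for z
  proof -
    obtain i where i: "i < n" "z = xs i" using zX by auto
    then have "i = 0" using xs_ends[of i 0] ze unfolding hl by auto
    then show ?thesis using i by simp
  qed
  moreover have "z = xs (n - 1)" if zX: "z \<in> set ?X" and ze: "z \<in> ends f (last p)" for z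
  proof -
    obtain i where i: "i < n" "z = xs i" using zX by auto
    then have "n = i \<or> n = Suc i" using xs_ends[of i n] ze unfolding hl by auto
    then show ?thesis using i by auto
  qed
  ultimately show thesis using that by blast
qed

text \<open>An odd path would yield a root path joining ends of equal colour. As it contains only
  one end of each of the two edges, it violates a separation.\<close>

lemma cross_separated_even_pair:
  assumes g: "cross_separated a b c d" and e: "e \<in> verts T" "ends f e = {a, b}" "e' \<in> verts T"
    "ends f e' = {c, d}"
  shows "even_pair T e e'"
proof -
  note g = g[unfolded cross_separated_def]
  have cols: "fst a \<noteq> fst b" "fst c \<noteq> fst d" "fst a = fst c" using ends_col e g by blast+
  then have neqs: "a \<noteq> c" "b \<noteq> d" "a \<noteq> d" "b \<noteq> c" using g by auto
  then have dis: "ends f e \<inter> ends f e' = {}" unfolding e by auto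
  then have ne: "e \<noteq> e'" using e by auto
  have na: "\<not> adj T e e'" using adj_iff[OF e(1,3) ne] dis by blast
  have "even (path_len p)" if p: "is_path T p" "hd p = e" "last p = e'" for p
  proof (rule ccontr)
    assume odd: "odd (path_len p)"
    obtain x X y where X: "apath x X y" "length X = path_len p" "x \<in> {a, b}" "y \<in> {c, d}"
     and end1: "\<And>z. z \<in> set X \<Longrightarrow> z \<in> {a, b} \<Longrightarrow> z = x" and end2: "\<And>z. z \<in> set X \<Longrightarrow> z \<in> {c, d} \<Longrightarrow> z = y"
      using path_to_root_path[OF p(1)] na ne p(2,3) e(2,4) by metis
    have "fst x = fst y" using apath_parity[OF X(1)] X(2) odd by simp
    then have "(x = a \<and> y = c) \<or> (x = b \<and> y = d)" using X(3,4) cols by auto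
    then show False
    proof
      assume xy: "x = a \<and> y = c"
      then have "b \<notin> set X" "d \<notin> set X" using end1[of b] end2[of d] cols by auto
      then show False using g X(1) xy unfolding separated_def by blast
    next
      assume xy: "x = b \<and> y = d"
      then have "a \<notin> set X" "c \<notin> set X" using end1[of a] end2[of c] cols by auto
      then show False using g X(1) xy unfolding separated_def by blast
    qed
  qed
  then show ?thesis unfolding even_pair_def strongly_antiadj_iff using e ne na by blast
qed

section \<open>From thetas of the root graph to odd prisms\<close>

definition edge_at :: "bool \<times> nat \<Rightarrow> bool \<times> nat \<Rightarrow> 'a" where
  "edge_at x y = (THE e. e \<in> verts T \<and> ends f e = {x, y})"

definition edge_list :: "(bool \<times> nat) list \<Rightarrow> 'a list" where
  "edge_list p = map (\<lambda>i. edge_at (p ! i) (p ! Suc i)) [0..<length p - 1]"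

lemma edge_at:
  assumes "root_edge T f x y"
  shows "edge_at x y \<in> verts T" "ends f (edge_at x y) = {x, y}"
proof -
  obtain e where e: "e \<in> verts T" "ends f e = {x, y}" using assms unfolding root_edge_def by blast
  then have "edge_at x y = e" unfolding edge_at_def using ends_inj by (intro the_equality) auto
  then show "edge_at x y \<in> verts T" "ends f (edge_at x y) = {x, y}" using e by auto
qed

lemma edge_list_nth:
  assumes "apath x p y" "Suc i < length p"
  shows "edge_list p ! i \<in> verts T" "ends f (edge_list p ! i) = {p ! i, p ! Suc i}"
proof -
  have "root_edge T f (p ! i) (p ! Suc i)" using assms unfolding apath_def
    by (auto dest: successively_nth)
  then show "edge_list p ! i \<in> verts T" "ends f (edge_list p ! i) = {p ! i, p ! Suc i}"
    using edge_at assms(2) unfolding edge_list_def by auto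
qed

lemma length_edge_list: "length (edge_list p) = length p - 1"
  by (simp add: edge_list_def)

lemma in_edge_list:
  assumes "u \<in> set (edge_list p)"
  obtains i where "Suc i < length p" "u = edge_list p ! i"
proof -
  obtain i where "i < length p - 1" "u = edge_list p ! i"
    using assms unfolding in_set_conv_nth length_edge_list by blast
  then show thesis using that[of i] by auto
qed

lemma edge_list_ends:
  assumes "apath x p y" "u \<in> set (edge_list p)"
  shows "ends f u \<subseteq> set p" "u \<in> verts T"
proof -
  obtain i where i: "Suc i < length p" "u = edge_list p ! i" using in_edge_list[OF assms(2)] .
  show "ends f u \<subseteq> set p" "u \<in> verts T" using edge_list_nth[OF assms(1) i(1)] i by auto
qed

lemma edge_list_eq_iff:
  assumes "apath x p y" "Suc i < length p" "Suc j < length p"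
  shows "edge_list p ! i = edge_list p ! j \<longleftrightarrow> i = j"
proof
  assume "edge_list p ! i = edge_list p ! j"
  then have "{p ! i, p ! Suc i} = {p ! j, p ! Suc j}" using edge_list_nth(2)[OF assms(1)] assms(2,3)
    by metis
  moreover have "distinct p" using assms(1) unfolding apath_def by blast
  ultimately show "i = j" using assms(2,3) by (auto simp: doubleton_eq_iff nth_eq_iff_index_eq)
qed simp

lemma distinct_edge_list: "apath x p y \<Longrightarrow> distinct (edge_list p)"
  unfolding distinct_conv_nth length_edge_list using edge_list_eq_iff by auto

lemma edge_list_adj:
  assumes p: "apath x p y" and u: "u \<in> set (edge_list p)" and w: "w \<in> set (edge_list p)" and "u \<noteq> w"
  shows "adj T u w \<longleftrightarrow> consec_in (edge_list p) u w"
proof -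
  obtain i where i: "Suc i < length p" "u = edge_list p ! i" using in_edge_list[OF u] .
  obtain j where j: "Suc j < length p" "w = edge_list p ! j" using in_edge_list[OF w] .
  have d: "distinct p" using p unfolding apath_def by blast
  have ij: "i \<noteq> j" using i j assms(4) by auto
  have "adj T u w \<longleftrightarrow> {p ! i, p ! Suc i} \<inter> {p ! j, p ! Suc j} \<noteq> {}"
    using adj_iff[of u w] edge_list_nth[OF p i(1)] edge_list_nth[OF p j(1)] i(2) j(2) assms(4)
      by simp
  also have "\<dots> \<longleftrightarrow> j = Suc i \<or> i = Suc j"
    using ij i(1) j(1) d by (auto simp: nth_eq_iff_index_eq)
  also have "\<dots> \<longleftrightarrow> consec_in (edge_list p) u w"
  proof
    assume "j = Suc i \<or> i = Suc j"
    then show "consec_in (edge_list p) u w"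
    proof
      assume "j = Suc i"
      then show ?thesis using i j unfolding consec_in_def length_edge_list
        by (intro exI[of _ i]) auto
    next
      assume "i = Suc j"
      then show ?thesis using i j unfolding consec_in_def length_edge_list
        by (intro exI[of _ j]) auto
    qed
  next
    assume "consec_in (edge_list p) u w"
    then obtain k where k: "Suc k < length p - 1"
      "(edge_list p ! k = u \<and> edge_list p ! Suc k = w) \<or> (edge_list p ! k = w
        \<and> edge_list p ! Suc k = u)"
      unfolding consec_in_def length_edge_list by blast
    then have "(k = i \<and> Suc k = j) \<or> (k = j \<and> Suc k = i)"
      using edge_list_eq_iff[OF p] i j by auto
    then show "j = Suc i \<or> i = Suc j" by auto
  qed
  finally show ?thesis .
qed

lemma edge_list_hd:
  assumes p: "apath x p y" "length p \<ge> 2" and u: "u \<in> set (edge_list p)"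
  shows "x \<in> ends f u \<longleftrightarrow> u = hd (edge_list p)" "y \<in> ends f u \<longleftrightarrow> u = last (edge_list p)"
proof -
  obtain i where i: "Suc i < length p" "u = edge_list p ! i" using in_edge_list[OF u] .
  have d: "distinct p" and ne: "p \<noteq> []" and xy: "x = p ! 0" "y = p ! (length p - 1)"
    using p(1) unfolding apath_def by (auto simp: hd_conv_nth last_conv_nth)
  have ene: "edge_list p \<noteq> []" using p(2) length_edge_list[of p] by auto
  then have hl: "hd (edge_list p) = edge_list p ! 0"
    "last (edge_list p) = edge_list p ! (length p - 2)"
    by (auto simp: hd_conv_nth last_conv_nth length_edge_list diff_diff_eq numeral_2_eq_2)
  have e: "ends f u = {p ! i, p ! Suc i}" using edge_list_nth[OF p(1) i(1)] i(2) by simp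
  have "x \<in> ends f u \<longleftrightarrow> i = 0" unfolding e xy using d i(1) ne p(2)
    by (auto simp: nth_eq_iff_index_eq)
  also have "\<dots> \<longleftrightarrow> u = hd (edge_list p)"
    unfolding hl i(2) using edge_list_eq_iff[OF p(1) i(1), of 0] p(2) by auto
  finally show "x \<in> ends f u \<longleftrightarrow> u = hd (edge_list p)" .
  have "p ! (length p - 1) = p ! i \<longleftrightarrow> length p - 1 = i"
    "p ! (length p - 1) = p ! Suc i \<longleftrightarrow> length p - 1 = Suc i"
    using d i(1) by (auto simp: nth_eq_iff_index_eq)
  then have "y \<in> ends f u \<longleftrightarrow> i = length p - 2" unfolding e xy using i(1) p(2) by auto
  also have "\<dots> \<longleftrightarrow> u = last (edge_list p)"
    unfolding hl i(2) using edge_list_eq_iff[OF p(1) i(1), of "length p - 2"] p(2) by auto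
  finally show "y \<in> ends f u \<longleftrightarrow> u = last (edge_list p)" .
qed

text \<open>A common edge would have to be \<open>xy\<close>, which cannot join vertices of the same
  colour.\<close>

lemma edge_list_disjoint:
  assumes "apath x p y" "apath x q y" "set p \<inter> set q = {x, y}" "fst x = fst y"
  shows "set (edge_list p) \<inter> set (edge_list q) = {}"
proof (rule ccontr)
  assume "\<not> ?thesis"
  then obtain u where "u \<in> set (edge_list p)" "u \<in> set (edge_list q)" by blast
  then have "ends f u \<subseteq> {x, y}" using edge_list_ends(1) assms by blast
  then show False using assms(4) by (auto simp: ends_def)
qed

text \<open>The two branches meet only in \<open>x\<close> and \<open>y\<close>, and on a branch
  only the first edge contains \<open>x\<close> and only the last contains \<open>y\<close>.\<close>

lemma edge_list_adj_other:
  assumes p: "apath x p y" "length p \<ge> 2" and q: "apath x q y" "length q \<ge> 2"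
    and i: "set p \<inter> set q = {x, y}" "fst x = fst y"
    and u: "u \<in> set (edge_list p)" and w: "w \<in> set (edge_list q)"
  shows "adj T u w \<longleftrightarrow> (u = hd (edge_list p) \<and> w = hd (edge_list q)) \<or> (u = last (edge_list p)
    \<and> w = last (edge_list q))"
proof -
  have "u \<noteq> w" using edge_list_disjoint[OF p(1) q(1) i] u w by blast
  then have "adj T u w \<longleftrightarrow> ends f u \<inter> ends f w \<noteq> {}" using adj_iff edge_list_ends(2) p(1) q(1) u w
    by blast
  also have "\<dots> \<longleftrightarrow> (x \<in> ends f u \<and> x \<in> ends f w) \<or> (y \<in> ends f u \<and> y \<in> ends f w)"
    using edge_list_ends(1)[OF p(1) u] edge_list_ends(1)[OF q(1) w] Int_insertD[OF i(1)] by blast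
  finally show ?thesis using edge_list_hd[OF p u] edge_list_hd[OF q w] by blast
qed

lemma consec_in_set: "consec_in p u w \<Longrightarrow> u \<in> set p \<and> w \<in> set p"
  unfolding consec_in_def by auto

text \<open>The edge lists of the branches are the three paths of the prism; the edges at
  \<open>p\<close> and those at \<open>q\<close> are its triangles. A branch has an odd number of
  vertices, at least three, so its edge list has an even number of members and is a path of odd
  length.\<close>

lemma theta_odd_prism:
  assumes th: "theta_graph p q A B C" and col: "fst p = fst q"
  shows "contains_odd_prism T"
proof -
  have t: "p \<noteq> q" "apath p A q" "apath p B q" "apath p C q"
     "set A \<inter> set B = {p, q}" "set A \<inter> set C = {p, q}" "set B \<inter> set C = {p, q}"
    using th by (auto simp: theta_graph_def)
  let ?A = "edge_list A" and ?B = "edge_list B" and ?C = "edge_list C"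
  have l2: "length A \<ge> 2" "length B \<ge> 2" "length C \<ge> 2" using apath_length2 t(1-4) by blast+
  moreover have odd: "odd (length A)" "odd (length B)" "odd (length C)"
    using apath_parity t(2-4) col by blast+
  ultimately have l3: "length A \<ge> 3" "length B \<ge> 3" "length C \<ge> 3" by presburger+
  have dis: "set ?A \<inter> set ?B = {}" "set ?A \<inter> set ?C = {}" "set ?B \<inter> set ?C = {}"
    using edge_list_disjoint t col by blast+
  have ne: "?A \<noteq> []" "?B \<noteq> []" "?C \<noteq> []"
    using l3 length_edge_list[of A] length_edge_list[of B] length_edge_list[of C] by auto
  have mem: "hd ?A \<in> set ?A" "hd ?B \<in> set ?B" "hd ?C \<in> set ?C" "last ?A \<in> set ?A" "last ?B \<in> set ?B"
    "last ?C \<in> set ?C"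
    using ne by auto
  have main: "adj T u w \<longleftrightarrow>
           ({u, w} \<subseteq> {hd P1, hd P2, hd P3}) \<or> ({u, w} \<subseteq> {last P1, last P2, last P3}) \<or>
           consec_in P1 u w \<or> consec_in P2 u w \<or> consec_in P3 u w"
    if u: "u \<in> set P1" and w: "w \<in> set P1 \<union> set P2" and uw: "u \<noteq> w"
      and P: "(P1, P2, P3) \<in> {(?A, ?B, ?C), (?A, ?C, ?B),
        (?B, ?A, ?C), (?B, ?C, ?A), (?C, ?A, ?B), (?C, ?B, ?A)}"
    for u w P1 P2 P3
  proof -
    have d: "set P1 \<inter> set P2 = {}" "set P1 \<inter> set P3 = {}" "set P2 \<inter> set P3 = {}"
      and m: "hd P1 \<in> set P1" "hd P2 \<in> set P2" "hd P3 \<in> set P3" "last P1 \<in> set P1"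
        "last P2 \<in> set P2" "last P3 \<in> set P3"
      using P dis mem by (auto simp: Int_commute)
    show ?thesis
    proof (cases "w \<in> set P1")
      case True
      have "adj T u w \<longleftrightarrow> consec_in P1 u w" using P u True uw edge_list_adj t(2-4) by blast
      moreover have "\<not> consec_in P2 u w" "\<not> consec_in P3 u w"
        using consec_in_set[of P2 u w] consec_in_set[of P3 u w] u d by auto
      moreover have "\<not> {u, w} \<subseteq> {hd P1, hd P2, hd P3}" "\<not> {u, w} \<subseteq> {last P1, last P2, last P3}"
        using u True uw d m by blast+
      ultimately show ?thesis by blast
    next
      case False
      then have w2: "w \<in> set P2" using w by blast
      have c: "set B \<inter> set A = {p, q}" "set C \<inter> set A = {p, q}" "set C \<inter> set B = {p, q}" using t
        by auto
      have "adj T u w \<longleftrightarrow> (u = hd P1 \<and> w = hd P2) \<or> (u = last P1 \<and> w = last P2)"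
        using P u w2
          edge_list_adj_other[OF t(2) l2(1) t(3) l2(2) t(5) col]
            edge_list_adj_other[OF t(2) l2(1) t(4) l2(3) t(6) col]
          edge_list_adj_other[OF t(3) l2(2) t(2) l2(1) c(1) col]
            edge_list_adj_other[OF t(3) l2(2) t(4) l2(3) t(7) col]
          edge_list_adj_other[OF t(4) l2(3) t(2) l2(1) c(2) col]
            edge_list_adj_other[OF t(4) l2(3) t(3) l2(2) c(3) col]
        by auto
      moreover have "\<not> consec_in P1 u w" "\<not> consec_in P2 u w" "\<not> consec_in P3 u w"
        using consec_in_set[of P1 u w] consec_in_set[of P2 u w] consec_in_set[of P3 u w] u w2 d
          by auto
      moreover have "{u, w} \<subseteq> {hd P1, hd P2, hd P3} \<longleftrightarrow> u = hd P1 \<and> w = hd P2"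
         "{u, w} \<subseteq> {last P1, last P2, last P3} \<longleftrightarrow> u = last P1 \<and> w = last P2"
        using u w2 d m by blast+
      ultimately show ?thesis by blast
    qed
  qed
  have ladj: "\<forall>u\<in>set ?A \<union> set ?B \<union> set ?C. \<forall>w\<in>set ?A \<union> set ?B \<union> set ?C. u \<noteq> w \<longrightarrow>
        (adj T u w \<longleftrightarrow> ({u, w} \<subseteq> {hd ?A, hd ?B, hd ?C}) \<or> ({u, w} \<subseteq> {last ?A, last ?B, last ?C}) \<or>
           consec_in ?A u w \<or> consec_in ?B u w \<or> consec_in ?C u w)"
  proof (intro ballI impI)
    fix u w assume u: "u \<in> set ?A \<union> set ?B \<union> set ?C" and w: "w \<in> set ?A \<union> set ?B \<union> set ?C" and uw:
      "u \<noteq> w"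
    obtain P1 P2 P3 where P:
      "(P1, P2, P3) \<in> {(?A, ?B, ?C), (?A, ?C, ?B),
      (?B, ?A, ?C), (?B, ?C, ?A), (?C, ?A, ?B), (?C, ?B, ?A)}"
       and uw': "u \<in> set P1" "w \<in> set P1 \<union> set P2"
      using u w that[of ?A ?B ?C] that[of ?A ?C ?B] that[of ?B ?A ?C] that[of ?B ?C ?A] that[of ?C ?A ?B]
        that[of ?C ?B ?A] by simp blast
    have "{hd P1, hd P2, hd P3} = {hd ?A, hd ?B, hd ?C}"
      "{last P1, last P2, last P3} = {last ?A, last ?B, last ?C}"
      "(consec_in P1 u w \<or> consec_in P2 u w \<or> consec_in P3 u w) = (consec_in ?A u w
        \<or> consec_in ?B u w \<or> consec_in ?C u w)"
      using P by auto
    then show "adj T u w \<longleftrightarrow> ({u, w} \<subseteq> {hd ?A, hd ?B, hd ?C})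
      \<or> ({u, w} \<subseteq> {last ?A, last ?B, last ?C}) \<or>
           consec_in ?A u w \<or> consec_in ?B u w \<or> consec_in ?C u w"
      using main[OF uw' uw P] by metis
  qed
  have "set ?A \<union> set ?B \<union> set ?C \<subseteq> verts T" using edge_list_ends(2) t(2-4) by blast
  then have "is_prism T ?A ?B ?C"
    unfolding is_prism_def using l3 length_edge_list dis distinct_edge_list t(2-4) ladj by auto
  moreover have "odd (path_len ?A)" "odd (path_len ?B)" "odd (path_len ?C)"
    using odd l3 unfolding path_len_def length_edge_list by auto
  ultimately show ?thesis unfolding contains_odd_prism_def by blast
qed

end

lemma semiadj_sym: "is_trigraph T \<Longrightarrow> semiadj T u v \<Longrightarrow> semiadj T v u"
  unfolding is_trigraph_def semiadj_def by metis

subsection \<open>The switchable component\<close>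

text \<open>\<open>card\<close> is 0 on infinite sets, so the bound on
  \<open>card (sw_components T)\<close> limits the number of components only together with
  finiteness.\<close>

lemma finite_sw_components:
  assumes "is_trigraph T" shows "finite (sw_components T)"
proof (rule finite_subset)
  show "sw_components T \<subseteq> (\<lambda>v. {u. (semiadj T)\<^sup>*\<^sup>* v u}) ` verts T" unfolding sw_components_def
    by auto
qed (use assms in \<open>simp add: is_trigraph_def\<close>)

text \<open>Every vertex of \<open>C\<close> lies in a switchable pair, so \<open>C\<close> is the
  union of one or two pairs, and connectedness makes two pairs share a vertex.\<close>

lemma sw_component_structure:
  assumes tri: "is_trigraph T" and C: "C \<in> sw_components T" and le2: "card (sw_edges_in T C) \<le> 2"
  shows "(\<exists>x y. semiadj T x y \<and> C = {x, y}) \<or>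
    (\<exists>v x y. x \<noteq> y \<and> semiadj T v x \<and> semiadj T v y \<and> C = {v, x, y}
      \<and> sw_edges_in T C = {{v, x}, {v, y}})"
proof -
  let ?S = "sw_edges_in T C"
  obtain z where z: "z \<in> verts T" and Cz: "C = {u. (semiadj T)\<^sup>*\<^sup>* z u}" and c2: "card C \<ge> 2"
    using C unfolding sw_components_def by auto
  have fC: "finite C" using c2 by (metis card.infinite not_numeral_le_zero)
  have closed: "u' \<in> C" if "u \<in> C" "semiadj T u u'" for u u'
    using that unfolding Cz by auto
  have S: "{u, u'} \<in> ?S" if "u \<in> C" "semiadj T u u'" for u u'
    using that closed unfolding sw_edges_in_def by blast
  have S': "\<exists>u v. F = {u, v} \<and> semiadj T u v \<and> u \<in> C \<and> v \<in> C" if "F \<in> ?S" for F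
    using that unfolding sw_edges_in_def by blast
  have fS: "finite ?S" using S' fC by (intro finite_subset[of ?S "Pow C"]) auto
  have nbr: "\<exists>u'. semiadj T u u'" if "u \<in> C" for u
  proof (cases "u = z")
    case True
    have "C \<noteq> {z}" using c2 by auto
    then obtain u' where "u' \<noteq> z" "(semiadj T)\<^sup>*\<^sup>* z u'" using that True unfolding Cz by blast
    then show ?thesis using True by (metis converse_rtranclpE)
  next
    case False
    have "(semiadj T)\<^sup>*\<^sup>* z u" using that Cz by blast
    then obtain u' where "semiadj T u' u" using False by (metis rtranclp.cases)
    then show ?thesis using semiadj_sym[OF tri] by blast
  qed
  have CS: "C = \<Union> ?S" using nbr S S' by blast
  have zC: "z \<in> C" unfolding Cz by simp
  then obtain z' where z': "semiadj T z z'" using nbr by blast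
  have zS: "{z, z'} \<in> ?S" using S[OF zC z'] .
  show ?thesis
  proof (cases "?S = {{z, z'}}")
    case True
    then have "C = {z, z'}" using CS by simp
    then show ?thesis using z' by blast
  next
    case False
    then obtain G where G: "G \<in> ?S" "G \<noteq> {z, z'}" using zS by blast
    have "card {{z, z'}, G} = 2" using G(2) by simp
    then have SG: "?S = {{z, z'}, G}"
      using card_subset_eq[OF fS, of "{{z, z'}, G}"] card_mono[OF fS, of "{{z, z'}, G}"] zS G(1) le2
      by simp
    obtain g g' where g: "G = {g, g'}" "semiadj T g g'" using S'[OF G(1)] by blast
    have "{z, z'} \<inter> G \<noteq> {}"
    proof
      assume dis: "{z, z'} \<inter> G = {}"
      \<comment> \<open>If the pairs were disjoint, nothing outside \<open>{z, z'}\<close> could be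
        reached from \<open>z\<close>, although \<open>G\<close> lies in \<open>C\<close>.\<close>
      have "u \<in> {z, z'}" if "(semiadj T)\<^sup>*\<^sup>* z u" for u
        using that
      proof induction
        case (step y u)
        have "y \<in> C" using step(1) Cz by simp
        then have "{y, u} \<in> ?S" using S step(2) by blast
        then have "{y, u} = {z, z'}" using SG step(3) dis by auto
        then show ?case by blast
      qed simp
      then have "C \<subseteq> {z, z'}" unfolding Cz by blast
      moreover have "g \<in> C" using CS G(1) g(1) by blast
      ultimately show False using dis g(1) by blast
    qed
    then obtain v x y where v: "{z, z'} = {v, x}" "G = {v, y}" "semiadj T v x" "semiadj T v y"
      using z' g semiadj_sym[OF tri] by blast
    have "x \<noteq> y" using v G(2) by blast
    moreover have "?S = {{v, x}, {v, y}}" using SG v by simp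
    moreover have "C = {v, x, y}" using CS SG v by auto
    ultimately show ?thesis using v by blast
  qed
qed

lemma swD_structure:
  assumes tri: "is_trigraph T" and F: "in_F T"
  shows "swD T = {} \<or> (\<exists>x y. semiadj T x y \<and> swD T = {x, y}) \<or>
    (\<exists>v x y. x \<noteq> y \<and> semiadj T v x \<and> semiadj T v y \<and> swD T = {v, x, y} \<and> strongly_antiadj T x y)"
proof (cases "sw_components T = {}")
  case True
  then show ?thesis by (simp add: swD_def)
next
  case False
  have "card (sw_components T) \<le> 1" using F by (simp add: in_F_def)
  then have "card (sw_components T) = 1" using False finite_sw_components[OF tri]
    by (metis card_0_eq le_antisym less_one not_less)
  then obtain C where C: "sw_components T = {C}" by (rule card_1_singletonE)
  have D: "swD T = C" unfolding swD_def C by simp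
  have Fc: "card (sw_edges_in T C) \<le> 2"
    "\<And>v x y. x \<noteq> y \<Longrightarrow> sw_edges_in T C = {{v, x}, {v, y}} \<Longrightarrow> strongly_antiadj T x y"
    using F C unfolding in_F_def by blast+
  have "C \<in> sw_components T" using C by simp
  from sw_component_structure[OF tri this Fc(1)] show ?thesis
    unfolding D using Fc(2) by (elim disjE exE conjE) blast+
qed

context line_trigraph_rep begin

lemma vertex_ends:
  assumes "e \<in> verts T" obtains p q where "ends f e = {p, q}" "root_edge T f p q"
  using assms unfolding root_edge_def ends_def by blast

text \<open>\<open>k\<close> is the end shared by \<open>x\<close> and \<open>y\<close>. A third
  edge at \<open>k\<close> would form a triangle with the switchable pair, so \<open>k\<close> has
  degree two.\<close>

lemma semiadj_ends:
  assumes "semiadj T x y"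
  obtains k u t where "ends f x = {k, u}" "ends f y = {k, t}" "u \<noteq> t" "k \<noteq> u" "k \<noteq> t"
    "\<And>g. g \<in> verts T \<Longrightarrow> k \<in> ends f g \<Longrightarrow> g = x \<or> g = y"
    "\<And>z. root_edge T f k z \<longleftrightarrow> z = u \<or> z = t"
proof -
  have xy: "x \<in> verts T" "y \<in> verts T" "x \<noteq> y" "adj T x y" using assms unfolding semiadj_def adj_def
    by auto
  obtain k where k: "k \<in> ends f x" "k \<in> ends f y" using adj_iff xy by blast
  obtain u where u: "ends f x = {k, u}" using ends_other[OF k(1)] by blast
  obtain t where t: "ends f y = {k, t}" using ends_other[OF k(2)] by blast
  have neqs: "k \<noteq> u" "k \<noteq> t" using ends_col u t by blast+
  have ut: "u \<noteq> t" using ends_inj xy u t by metis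
  have only: "g = x \<or> g = y" if g: "g \<in> verts T" "k \<in> ends f g" for g
  proof (rule ccontr)
    assume n: "\<not> ?thesis"
    then have "adj T x g" "adj T y g" using adj_iff xy g k by blast+
    then have "strongly_adj T x y" using strong_triangle xy(4) by blast
    then show False using assms not_strong_antiadj(2) by blast
  qed
  have "root_edge T f k z \<longleftrightarrow> z = u \<or> z = t" for z
  proof
    assume "root_edge T f k z"
    then obtain g where g: "g \<in> verts T" "ends f g = {k, z}" unfolding root_edge_def by blast
    then have "g = x \<or> g = y" using only by blast
    then show "z = u \<or> z = t" using g(2) u t by (auto simp: doubleton_eq_iff)
  next
    assume "z = u \<or> z = t"
    then show "root_edge T f k z" using u t xy unfolding root_edge_def by blast
  qed
  then show thesis using that u t neqs ut only by blast
qed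

lemma nonadjacent_ends:
  assumes "strongly_antiadj T e e'" shows "ends f e \<inter> ends f e' = {}"
  using assms adj_iff unfolding strongly_antiadj_iff by blast

end

section \<open>Even pairs disjoint from the switchable component\<close>

locale prism_free_line_trigraph = line_trigraph_rep +
  assumes no_odd_prism: "\<not> contains_odd_prism T"
begin

sublocale even_theta_free "root_edge T f" fst
  by unfold_locales (use theta_odd_prism no_odd_prism in blast)

text \<open>Nonadjacent vertices of \<open>T\<close> are disjoint root edges, so
  \<open>cross_separated_avoiding\<close> applies, and the edges it returns form an even
  pair.\<close>

lemma even_pair_avoiding:
  assumes "W \<noteq> {} \<Longrightarrow> w \<in> W" "W \<subseteq> {w, v}"
    and "W \<noteq> {} \<Longrightarrow> v \<noteq> t" "\<And>y. W \<noteq> {} \<Longrightarrow> root_edge T f w y \<longleftrightarrow> y = v \<or> y = t"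
    and "v \<in> W \<Longrightarrow> \<exists>t'. \<forall>y. root_edge T f v y \<longleftrightarrow> y = w \<or> y = t'"
    and e: "strongly_antiadj T e e'"
    and av: "W \<noteq> {} \<Longrightarrow> (ends f e \<union> ends f e') \<inter> {w, v} = {}"
  shows "\<exists>g g'. even_pair T g g' \<and> ends f g \<inter> W = {} \<and> ends f g' \<inter> W = {}"
proof -
  have V: "e \<in> verts T" "e' \<in> verts T" using e unfolding strongly_antiadj_def by auto
  obtain e1 e2 where e12: "ends f e = {e1, e2}" "root_edge T f e1 e2" using vertex_ends[OF V(1)] .
  obtain f1 f2 where f12: "ends f e' = {f1, f2}" "root_edge T f f1 f2" using vertex_ends[OF V(2)] .
  have dis: "{e1, e2} \<inter> {f1, f2} = {}" using nonadjacent_ends[OF e] e12 f12 by simp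
  have av': "{e1, e2, f1, f2} \<inter> {w, v} = {}" if "W \<noteq> {}" using av[OF that] e12 f12 by auto
  have "\<exists>p q r s. cross_separated p q r s \<and> {p, q, r, s} \<inter> W = {}"
    by (rule cross_separated_avoiding[where w = w and v = v
      and t = t, OF _ _ _ _ _ e12(2) f12(2) dis])
      (erule assms | rule assms | erule av')+
  then obtain p q r s where g: "cross_separated p q r s" and W: "{p, q, r, s} \<inter> W = {}" by blast
  have E: "root_edge T f p q" "root_edge T f r s" using g unfolding cross_separated_def by auto
  then obtain g g' where "g \<in> verts T" "ends f g = {p, q}" "g' \<in> verts T" "ends f g' = {r, s}"
    unfolding root_edge_def by blast
  moreover from this have "even_pair T g g'" using cross_separated_even_pair g by blast
  ultimately show ?thesis using W by (intro exI[of _ g] exI[of _ g']) auto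
qed

text \<open>For \<open>W = {}\<close> the conditions on \<open>w\<close>, \<open>v\<close>,
  \<open>t\<close> hold for any values, hence \<open>undefined\<close>.\<close>

lemma even_pair_if_nonadjacent:
  "strongly_antiadj T e e' \<Longrightarrow> \<exists>g g'. even_pair T g g'"
  using even_pair_avoiding[of "{}" undefined undefined undefined e e'] by blast

text \<open>\<open>W\<close> consists of the end \<open>k\<close> shared by \<open>x\<close> and
  \<open>y\<close>, and the other end \<open>u\<close> of \<open>x\<close> plays the role of
  \<open>v\<close>. Nonneighbours of \<open>x\<close> are edges that avoid both \<open>k\<close> and
  \<open>u\<close>, and an edge avoiding \<open>k\<close> is neither \<open>x\<close> nor
  \<open>y\<close>.\<close>

lemma even_pair_small:
  assumes xy: "semiadj T x y" and D: "swD T = {x, y}" and nc: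
    "\<not> is_clique T (verts T - (swD T \<union> nbhd T x))"
  shows "\<exists>g g'. even_pair T g g' \<and> g \<notin> swD T \<and> g' \<notin> swD T"
proof -
  have xV: "x \<in> verts T" using xy unfolding semiadj_def by blast
  obtain e e' where e: "e \<in> verts T - (swD T \<union> nbhd T x)" "e' \<in> verts T - (swD T \<union> nbhd T x)"
    "e \<noteq> e'" "\<not> adj T e e'"
    using nc unfolding is_clique_def by blast
  then have anti: "strongly_antiadj T e e'" unfolding strongly_antiadj_iff by blast
  obtain k u t where k: "ends f x = {k, u}" "ends f y = {k, t}" "u \<noteq> t" "k \<noteq> u" "k \<noteq> t"
    "\<And>z. root_edge T f k z \<longleftrightarrow> z = u \<or> z = t"
    using semiadj_ends[OF xy] by metis
  have far: "ends f g \<inter> {k, u} = {}" if g: "g \<in> verts T - (swD T \<union> nbhd T x)" for g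
  proof -
    have "g \<in> verts T" "g \<noteq> x" "\<not> adj T x g" using g D unfolding nbhd_def by auto
    then show ?thesis using adj_iff[OF xV] k(1) by blast
  qed
  have "\<exists>g g'. even_pair T g g' \<and> ends f g \<inter> {k} = {} \<and> ends f g' \<inter> {k} = {}"
  proof (rule even_pair_avoiding[of "{k}" k u t e e'])
    show "(ends f e \<union> ends f e') \<inter> {k, u} = {}" using far e by blast
  qed (use k anti in auto)
  then show ?thesis using k(1,2) D by auto
qed

text \<open>The middle vertex \<open>v\<close> is a root edge \<open>ku\<close> whose two ends have
  degree two, so \<open>W = {k, u}\<close>. The edges that meet \<open>W\<close> are exactly
  \<open>v\<close>, \<open>x\<close> and \<open>y\<close>.\<close>

lemma even_pair_light:
  assumes vx: "semiadj T v x" and vy: "semiadj T v y" and xy: "strongly_antiadj T x y" and D: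
    "swD T = {v, x, y}"
    and anti: "strongly_antiadj T e e'" and eD: "e \<notin> swD T" "e' \<notin> swD T"
  shows "\<exists>g g'. even_pair T g g' \<and> g \<notin> swD T \<and> g' \<notin> swD T"
proof -
  obtain k u t where k: "ends f v = {k, u}" "ends f x = {k, t}" "u \<noteq> t" "k \<noteq> u" "k \<noteq> t"
    "\<And>g. g \<in> verts T \<Longrightarrow> k \<in> ends f g \<Longrightarrow> g = v \<or> g = x"
    "\<And>z. root_edge T f k z \<longleftrightarrow> z = u \<or> z = t"
    using semiadj_ends[OF vx] by metis
  obtain l u' t' where l: "ends f v = {l, u'}" "ends f y = {l, t'}" "l \<noteq> u'"
    "\<And>g. g \<in> verts T \<Longrightarrow> l \<in> ends f g \<Longrightarrow> g = v \<or> g = y"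
    "\<And>z. root_edge T f l z \<longleftrightarrow> z = u' \<or> z = t'"
    using semiadj_ends[OF vy] by metis
  have "l \<noteq> k" using nonadjacent_ends[OF xy] k(2) l(2) by blast
  \<comment> \<open>Being disjoint, the edges \<open>x\<close> and \<open>y\<close> meet
    \<open>v\<close> in different ends.\<close>
  then have lu: "l = u" "u' = k" using k(1) l(1) by (auto simp: doubleton_eq_iff)
  have V: "e \<in> verts T" "e' \<in> verts T" using anti unfolding strongly_antiadj_def by auto
  have far: "ends f g \<inter> {k, u} = {}" if "g \<in> verts T" "g \<notin> swD T" for g
    using that k(6)[of g] l(4)[of g] lu D by auto
  have "\<exists>g g'. even_pair T g g' \<and> ends f g \<inter> {k, u} = {} \<and> ends f g' \<inter> {k, u} = {}"
  proof (rule even_pair_avoiding[of "{k, u}" k u t e e'])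
    show "(ends f e \<union> ends f e') \<inter> {k, u} = {}" using far V eD by blast
    show "\<exists>t'. \<forall>z. root_edge T f u z \<longleftrightarrow> z = k \<or> z = t'" using l(5) lu by blast
  qed (use k anti in auto)
  then obtain g g' where g: "even_pair T g g'" "k \<notin> ends f g" "u \<notin> ends f g" "k \<notin> ends f g'"
    "u \<notin> ends f g'"
    by blast
  have "h \<notin> swD T" if "k \<notin> ends f h" "u \<notin> ends f h" for h
    using that k(1,2) l(2) lu D by auto
  then show ?thesis using g by blast
qed

end

theorem theorem4p5:
  fixes T :: "'a trigraph"
  assumes "is_trigraph T"
    and "in_F T"
    and "line_trigraph T"
    and "\<not> contains_odd_prism T"
  shows "(complete T \<or> (\<exists>u v. even_pair T u v)) \<and>
         (favorable T \<longrightarrow> (\<exists>u v. even_pair T u v \<and> u \<notin> swD T \<and> v \<notin> swD T))"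
proof -
  obtain f :: "'a \<Rightarrow> nat \<times> nat" where "inj_on f (verts T)"
    "\<forall>u\<in>verts T. \<forall>v\<in>verts T. u \<noteq> v \<longrightarrow> (adj T u v \<longleftrightarrow> fst (f u) = fst (f v) \<or> snd (f u) = snd (f v))"
    using assms(3) unfolding line_trigraph_def line_graph_of_bipartite_def by blast
  then interpret prism_free_line_trigraph T f
    using assms unfolding line_trigraph_def by unfold_locales blast+
  have "complete T \<or> (\<exists>u v. even_pair T u v)"
    using even_pair_if_nonadjacent unfolding complete_def is_clique_def strongly_antiadj_iff
      by blast
  moreover have "\<exists>u v. even_pair T u v \<and> u \<notin> swD T \<and> v \<notin> swD T" if fav: "favorable T"
  proof -
    obtain e e' where e: "strongly_antiadj T e e'" "e \<notin> swD T" "e' \<notin> swD T"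
      using fav unfolding favorable_def by blast
    consider "swD T = {}" | x y where "semiadj T x y" "swD T = {x, y}"
      | v x y where "x \<noteq> y" "semiadj T v x" "semiadj T v y" "swD T = {v, x, y}"
        "strongly_antiadj T x y"
      using swD_structure[OF assms(1,2)] by blast
    then show ?thesis
    proof cases
      case 1
      then show ?thesis using even_pair_if_nonadjacent[OF e(1)] by simp
    next
      case (2 x y)
      have "x \<noteq> y" using 2(1) unfolding semiadj_def by blast
      then have "\<not> is_clique T (verts T - (swD T \<union> nbhd T x))
        \<or> \<not> is_clique T (verts T - (swD T \<union> nbhd T y))"
        using fav 2 unfolding favorable_def by blast
      \<comment> \<open>The third condition of favorability allows either vertex of the small
        component, hence both orders of \<open>x\<close> and \<open>y\<close>.\<close>
      then show ?thesis
        using even_pair_small[OF 2] even_pair_small[OF semiadj_sym[OF assms(1) 2(1)]] 2(2)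
          by (auto simp: insert_commute)
    next
      case (3 v x y)
      then show ?thesis using even_pair_light[OF _ _ _ _ e] by blast
    qed
  qed
  ultimately show ?thesis by blast
qed

end
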